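(* Let $n,k,m\in\mathbb N$ with $n\ge 2$, $m\ge 2$ and $1\le k\le m-1$. Assume that $1\le p\le q<\infty$ and $$\frac1q\ <\ \frac{n-p(m-k)}{np}.$$ Let $r\in\mathbb R$. Then, for every nonempty bounded open set $\Omega\subset\mathbb R^n$ with smooth boundary, with associated function $d:\Omega\to(0,\infty)$ as described in the context, there is no constant $C$ such that $$\left\|\frac{u}{d^{\,m-k}}\right\|_{W^{k,q}(\Omega,d^{r})}\ \le\ C\,\|u\|_{W^{m,p}(\Omega,d^{p-1})}$$ for every $u\in W^{m,p}_0(\Omega,d^{p-1})$.
   Context: The function $d$: for a bounded open set $\Omega\subset\mathbb R^n$ with smooth ($C^\infty$) boundary, the distance function $x\mapsto \mathrm{dist}(x,\partial\Omega)$ is smooth in a sufficiently narrow neighborhood of $\partial\Omega$ in $\Omega$. One fixes a function $d:\Omega\to(0,\infty)$ which agrees with the distance function from $\partial\Omega$ in such a neighborhood of $\partial\Omega$, and which is smooth in the whole of $\Omega$. Weighted spaces: for $p\in[1,\infty)$ and $\alpha\in\mathbb R$, $L^p(\Omega,d^\alpha)$ is the space with norm $\|u\|_{L^p(\Omega,d^\alpha)}=\big(\int_\Omega|u(x)|^p d(x)^\alpha\,dx\big)^{1/p}$ for measurable $u$ on $\Omega$. For $m\in\mathbb N$, $W^{m,p}(\Omega,d^\alpha)$ is the space of $m$-times weakly differentiable functions $u$ in $\Omega$ with finite norm $\|u\|_{W^{m,p}(\Omega,d^\alpha)}=\sum_{j=0}^m\|\nabla^j u\|_{L^p(\Omega,d^\alpha)}$,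 where $\nabla^j u$ is the vector of all derivatives of $u$ of order $j$, and $\nabla^0u=u$. $W^{m,p}_0(\Omega,d^\alpha)$ is the closure of $C_0^\infty(\Omega)$ (smooth functions with compact support in $\Omega$) in $W^{m,p}(\Omega,d^\alpha)$. *)

theory Defs
  imports "HOL-Analysis.Analysis"
begin

definition partial_deriv :: "'n \<Rightarrow> (real^'n \<Rightarrow> real) \<Rightarrow> real^'n \<Rightarrow> real" where
  "partial_deriv i f x = frechet_derivative f (at x) (axis i 1)"

primrec iter_partial :: "'n list \<Rightarrow> (real^'n \<Rightarrow> real) \<Rightarrow> real^'n \<Rightarrow> real" where
  "iter_partial [] f = f"
| "iter_partial (i # js) f = partial_deriv i (iter_partial js f)"

text \<open>For open \<open>S\<close> this is the usual \<open>C\<^sup>\<infinity>\<close> regularity: differentiability of every iterated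
  partial derivative makes all of them exist and be continuous.\<close>

definition smooth_on :: "(real^'n) set \<Rightarrow> (real^'n \<Rightarrow> real) \<Rightarrow> bool" where
  "smooth_on S f \<longleftrightarrow> (\<forall>js. \<forall>x\<in>S. iter_partial js f differentiable (at x))"

text \<open>Locally, up to permuting and reflecting the coordinate axes, \<open>\<Omega>\<close> is the region above
  the graph of a smooth function of the remaining coordinates. That function is represented
  by a smooth \<open>g\<close> on the whole space that does not depend on the \<open>i\<close>-th coordinate.\<close>

definition smooth_boundary :: "(real^'n) set \<Rightarrow> bool" where
  "smooth_boundary \<Omega> \<longleftrightarrow>
     (\<forall>z\<in>frontier \<Omega>. \<exists>\<rho>>0. \<exists>i. \<exists>s\<in>{1, -1}. \<exists>g.
        smooth_on UNIV g \<and>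
        (\<forall>x t. g (x + t *\<^sub>R axis i 1) = g x) \<and>
        \<Omega> \<inter> ball z \<rho> = {x \<in> ball z \<rho>. s * x $ i > g x})"

text \<open>Since \<open>frontier \<Omega>\<close> is compact for bounded \<open>\<Omega>\<close>, every neighbourhood of it contains a tube
  of some width \<open>\<delta>\<close>.\<close>

definition smoothed_distance :: "(real^'n) set \<Rightarrow> (real^'n \<Rightarrow> real) \<Rightarrow> bool" where
  "smoothed_distance \<Omega> d \<longleftrightarrow>
     (\<forall>x\<in>\<Omega>. d x > 0) \<and> smooth_on \<Omega> d \<and>
     (\<exists>\<delta>>0. \<forall>x\<in>\<Omega>. infdist x (frontier \<Omega>) < \<delta> \<longrightarrow> d x = infdist x (frontier \<Omega>))"

text \<open>Elements of \<open>C\<^sub>0\<^sup>\<infinity>(\<Omega>)\<close>, extended by zero to the whole space.\<close>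

definition test_functions :: "(real^'n) set \<Rightarrow> (real^'n \<Rightarrow> real) set" where
  "test_functions \<Omega> =
     {\<phi>. smooth_on UNIV \<phi> \<and> compact (closure {x. \<phi> x \<noteq> 0}) \<and> closure {x. \<phi> x \<noteq> 0} \<subseteq> \<Omega>}"

definition locally_integrable :: "(real^'n) set \<Rightarrow> (real^'n \<Rightarrow> real) \<Rightarrow> bool" where
  "locally_integrable \<Omega> u \<longleftrightarrow> (\<forall>K. compact K \<and> K \<subseteq> \<Omega> \<longrightarrow> u absolutely_integrable_on K)"

definition has_weak_deriv ::
    "(real^'n) set \<Rightarrow> 'n list \<Rightarrow> (real^'n \<Rightarrow> real) \<Rightarrow> (real^'n \<Rightarrow> real) \<Rightarrow> bool" where
  "has_weak_deriv \<Omega> js u v \<longleftrightarrow>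
     locally_integrable \<Omega> u \<and> locally_integrable \<Omega> v \<and>
     (\<forall>\<phi>\<in>test_functions \<Omega>.
        (LINT x:\<Omega>|lebesgue. u x * iter_partial js \<phi> x) =
        (- 1) ^ length js * (LINT x:\<Omega>|lebesgue. v x * \<phi> x))"

definition weakly_differentiable :: "(real^'n) set \<Rightarrow> nat \<Rightarrow> (real^'n \<Rightarrow> real) \<Rightarrow> bool" where
  "weakly_differentiable \<Omega> m u \<longleftrightarrow> (\<forall>js. length js \<le> m \<longrightarrow> (\<exists>v. has_weak_deriv \<Omega> js u v))"

text \<open>Functions represent their almost-everywhere classes, so the choice below is unique up to
  null sets whenever the weak derivative exists.\<close>

definition weak_deriv :: "(real^'n) set \<Rightarrow> 'n list \<Rightarrow> (real^'n \<Rightarrow> real) \<Rightarrow> real^'n \<Rightarrow> real" where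
  "weak_deriv \<Omega> js u = (if js = [] then u else (SOME v. has_weak_deriv \<Omega> js u v))"

text \<open>Euclidean length of the vector of all derivatives
  \<open>\<partial>\<^bsub>i1\<^esub> \<dots> \<partial>\<^bsub>ij\<^esub> u\<close>, one entry for each of the \<open>n\<^sup>j\<close> index tuples.\<close>

definition grad_norm :: "(real^'n) set \<Rightarrow> nat \<Rightarrow> (real^'n \<Rightarrow> real) \<Rightarrow> real^'n \<Rightarrow> real" where
  "grad_norm \<Omega> j u x = L2_set (\<lambda>js. weak_deriv \<Omega> js u x) {js. length js = j}"

text \<open>The norms take the value \<open>\<infinity>\<close> on functions outside the space.\<close>

definition weighted_Lp_norm ::
    "(real^'n) set \<Rightarrow> (real^'n \<Rightarrow> real) \<Rightarrow> real \<Rightarrow> real \<Rightarrow> (real^'n \<Rightarrow> real) \<Rightarrow> ennreal" where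
  "weighted_Lp_norm \<Omega> d \<alpha> p f =
     (let J = \<integral>\<^sup>+x\<in>\<Omega>. ennreal (\<bar>f x\<bar> powr p * d x powr \<alpha>) \<partial>lebesgue
      in if J = \<infinity> then \<infinity> else ennreal (enn2real J powr (1 / p)))"

definition sobolev_norm ::
    "(real^'n) set \<Rightarrow> (real^'n \<Rightarrow> real) \<Rightarrow> real \<Rightarrow> nat \<Rightarrow> real \<Rightarrow> (real^'n \<Rightarrow> real) \<Rightarrow> ennreal" where
  "sobolev_norm \<Omega> d \<alpha> m p u =
     (if weakly_differentiable \<Omega> m u
      then \<Sum>j\<le>m. weighted_Lp_norm \<Omega> d \<alpha> p (grad_norm \<Omega> j u) else \<infinity>)"

definition sobolev_space ::
    "(real^'n) set \<Rightarrow> (real^'n \<Rightarrow> real) \<Rightarrow> real \<Rightarrow> nat \<Rightarrow> real \<Rightarrow> (real^'n \<Rightarrow> real) set" where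
  "sobolev_space \<Omega> d \<alpha> m p =
     {u. weakly_differentiable \<Omega> m u \<and> sobolev_norm \<Omega> d \<alpha> m p u < \<infinity>}"

definition sobolev_space_0 ::
    "(real^'n) set \<Rightarrow> (real^'n \<Rightarrow> real) \<Rightarrow> real \<Rightarrow> nat \<Rightarrow> real \<Rightarrow> (real^'n \<Rightarrow> real) set" where
  "sobolev_space_0 \<Omega> d \<alpha> m p =
     {u \<in> sobolev_space \<Omega> d \<alpha> m p.
        \<forall>\<epsilon>>0. \<exists>\<phi>\<in>test_functions \<Omega>. sobolev_norm \<Omega> d \<alpha> m p (\<lambda>x. u x - \<phi> x) < \<epsilon>}"

end

theory Submission
  imports Defs
begin

text \<open>The exponent condition says that \<open>n/q - k < n/p - m\<close>, so already the local embedding of \<open>W^{m,p}\<close>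
  into \<open>W^{k,q}\<close> fails by scaling; on a fixed interior ball the weights are bounded above and away
  from zero and play no role. Fix a bump \<open>\<psi>\<close> and let \<open>\<phi> = \<partial>\<^sub>i^k \<psi>\<close>, which is not identically zero. The
  functions \<open>u\<^sub>\<epsilon> x = \<phi> ((x - c) / \<epsilon>)\<close> have norm at most \<open>A \<epsilon>^(n/p - m)\<close>. Let \<open>w\<close> be a weak derivative
  \<open>\<partial>\<^sub>i^k (u\<^sub>\<epsilon> / d^(m - k))\<close>. Testing it against \<open>\<psi>\<^sub>\<epsilon> x = \<psi> ((x - c) / \<epsilon>)\<close>, whose \<open>k\<close>-th derivative is
  \<open>\<epsilon>^(-k) u\<^sub>\<epsilon>\<close>, gives \<open>|\<integral> w \<psi>\<^sub>\<epsilon>| = \<epsilon>^(-k) \<integral> u\<^sub>\<epsilon>^2 / d^(m - k)\<close>, which is at least of order \<open>\<epsilon>^(n - k)\<close>.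
  Hence the \<open>L^q\<close> norm of \<open>w\<close> is at least \<open>a \<epsilon>^(n/q - k)\<close>, and letting \<open>\<epsilon>\<close> tend to zero yields a
  contradiction.\<close>

section \<open>Calculus of smooth functions\<close>

lemma partial_deriv_eqI:
  "(f has_derivative f') (at x) \<Longrightarrow> partial_deriv i f x = f' (axis i 1)"
  unfolding partial_deriv_def by (metis frechet_derivative_at)

lemma iter_partial_append: "iter_partial (js @ ks) f = iter_partial js (iter_partial ks f)"
  by (induction js) auto

text \<open>Smoothness is the largest property that implies differentiability and survives partial
  differentiation. Any invariant \<open>P\<close> of this kind therefore suffices, and no closed
  form for iterated derivatives has to be found.\<close>

lemma smooth_on_coinduct:
  assumes "P f"
    and diff: "\<And>g x. P g \<Longrightarrow> g differentiable (at x)"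
    and step: "\<And>g i. P g \<Longrightarrow> P (partial_deriv i g)"
  shows "smooth_on UNIV f"
proof -
  have "P (iter_partial js f)" for js
    by (induction js) (use assms in auto)
  then show ?thesis
    unfolding smooth_on_def using diff by blast
qed

lemma smooth_on_differentiable: "smooth_on S f \<Longrightarrow> x \<in> S \<Longrightarrow> f differentiable (at x)"
  unfolding smooth_on_def by (metis iter_partial.simps(1))

lemma smooth_on_iter_partial: "smooth_on S f \<Longrightarrow> smooth_on S (iter_partial js f)"
  unfolding smooth_on_def by (metis iter_partial_append)

lemma smooth_on_partial_deriv: "smooth_on S f \<Longrightarrow> smooth_on S (partial_deriv i f)"
  using smooth_on_iter_partial[of S f "[i]"] by simp

lemma smooth_on_continuous_on: "smooth_on S f \<Longrightarrow> continuous_on S f"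
  by (meson continuous_at_imp_continuous_on differentiable_imp_continuous_within
      smooth_on_differentiable)

lemma smooth_on_has_derivative:
  "smooth_on UNIV f \<Longrightarrow> (f has_derivative frechet_derivative f (at x)) (at x)"
  using frechet_derivative_works smooth_on_differentiable by blast

lemma smooth_on_affine_coord: "smooth_on UNIV (\<lambda>x::real^'n. a * x $ i + b)"
proof (rule smooth_on_coinduct[where P = "\<lambda>f. \<exists>a b. f = (\<lambda>x. a * x $ i + b)"])
  fix g :: "real^'n \<Rightarrow> real" and x and j
  assume "\<exists>a b. g = (\<lambda>x. a * x $ i + b)"
  then obtain a b where g: "g = (\<lambda>x. a * x $ i + b)" by blast
  have *: "(g has_derivative (\<lambda>h. a * h $ i)) (at x)" for x
    unfolding g by (auto intro!: derivative_eq_intros bounded_linear_imp_has_derivative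
        bounded_linear_vec_nth)
  then show "g differentiable (at x)"
    by (auto simp: differentiable_def)
  show "\<exists>a b. partial_deriv j g = (\<lambda>x. a * x $ i + b)"
    by (rule exI[of _ 0], rule exI[of _ "a * axis j 1 $ i"])
      (auto simp: fun_eq_iff partial_deriv_eqI[OF *])
qed blast

text \<open>The closure of the smooth functions under sums, products and composition with a sequence
  of successive derivatives on the line is stable under partial differentiation.\<close>

inductive smooth_alg :: "(nat \<Rightarrow> real \<Rightarrow> real) \<Rightarrow> (real^'n \<Rightarrow> real) \<Rightarrow> bool" for G where
  base: "smooth_on UNIV f \<Longrightarrow> smooth_alg G f"
| comp: "smooth_on UNIV f \<Longrightarrow> smooth_alg G (\<lambda>x. G l (f x))"
| add: "smooth_alg G f \<Longrightarrow> smooth_alg G g \<Longrightarrow> smooth_alg G (\<lambda>x. f x + g x)"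
| mult: "smooth_alg G f \<Longrightarrow> smooth_alg G g \<Longrightarrow> smooth_alg G (\<lambda>x. f x * g x)"

text \<open>The chain and product rules write each partial derivative again as sums and products of
  members of the algebra. The chain rule turns \<open>G l\<close> into \<open>G (Suc l)\<close>,
  which is why a whole sequence \<open>G\<close> enters.\<close>

lemma smooth_alg_smooth:
  assumes G: "\<And>l t. (G l has_real_derivative G (Suc l) t) (at t)"
    and "smooth_alg G f"
  shows "smooth_on UNIV f"
proof -
  have *: "(\<forall>x. g differentiable (at x)) \<and> (\<forall>i. smooth_alg G (partial_deriv i g))"
    if "smooth_alg G g" for g :: "real^'n \<Rightarrow> real"
    using that
  proof induction
    case (base f)
    then show ?case
      by (simp add: smooth_alg.base smooth_on_partial_deriv smooth_on_differentiable)
  next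
    case (comp f l)
    have D: "((\<lambda>x. G l (f x)) has_derivative
        (\<lambda>h. G (Suc l) (f x) * frechet_derivative f (at x) h)) (at x)" for x
      using has_derivative_compose[OF smooth_on_has_derivative[OF comp]
          G[of l "f x", THEN has_field_derivative_imp_has_derivative]] by simp
    have "partial_deriv i (\<lambda>x. G l (f x)) = (\<lambda>x. G (Suc l) (f x) * partial_deriv i f x)" for i
      by (auto simp: fun_eq_iff partial_deriv_eqI[OF D] partial_deriv_def)
    then show ?case
      using D smooth_alg.mult[OF smooth_alg.comp[OF comp]
          smooth_alg.base[OF smooth_on_partial_deriv[OF comp]]]
      by (simp add: differentiable_def) blast
  next
    case (add f g)
    then have D: "((\<lambda>x. f x + g x) has_derivative
        (\<lambda>h. frechet_derivative f (at x) h + frechet_derivative g (at x) h)) (at x)" for x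
      by (intro has_derivative_add) (auto simp: frechet_derivative_works)
    have "partial_deriv i (\<lambda>x. f x + g x) = (\<lambda>x. partial_deriv i f x + partial_deriv i g x)" for i
      by (auto simp: fun_eq_iff partial_deriv_eqI[OF D] partial_deriv_def)
    then show ?case
      using D add smooth_alg.add by (simp add: differentiable_def) blast
  next
    case (mult f g)
    then have D: "((\<lambda>x. f x * g x) has_derivative
        (\<lambda>h. f x * frechet_derivative g (at x) h + frechet_derivative f (at x) h * g x)) (at x)" for x
      by (intro has_derivative_mult) (auto simp: frechet_derivative_works)
    have "partial_deriv i (\<lambda>x. f x * g x)
        = (\<lambda>x. f x * partial_deriv i g x + partial_deriv i f x * g x)" for i
      by (auto simp: fun_eq_iff partial_deriv_eqI[OF D] partial_deriv_def)
    then show ?case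
      using D mult smooth_alg.add[OF smooth_alg.mult smooth_alg.mult]
      by (simp add: differentiable_def) blast
  qed
  show ?thesis
    by (rule smooth_on_coinduct[of "smooth_alg G"]) (use * assms in auto)
qed

lemma smooth_on_compose:
  assumes "\<And>l t. (G l has_real_derivative G (Suc l) t) (at t)" "smooth_on UNIV f"
  shows "smooth_on UNIV (\<lambda>x. G l (f x))"
  by (rule smooth_alg_smooth[of G, OF assms(1) smooth_alg.comp[OF assms(2)]])

lemma
  assumes "smooth_on UNIV f" "smooth_on UNIV g"
  shows smooth_on_add: "smooth_on UNIV (\<lambda>x. f x + g x)"
    and smooth_on_mult: "smooth_on UNIV (\<lambda>x. f x * g x)"
proof -
  \<comment> \<open>The zero sequence satisfies the hypothesis on \<open>G\<close> trivially and
    leaves only the closure under sums and products.\<close>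
  have "((\<lambda>_. 0) has_real_derivative 0) (at t)" for t :: real by simp
  note * = smooth_alg_smooth[of "\<lambda>_ _. 0", OF this] and ** = assms[THEN smooth_alg.base]
  show "smooth_on UNIV (\<lambda>x. f x + g x)" "smooth_on UNIV (\<lambda>x. f x * g x)"
    by (rule *[OF smooth_alg.add[OF **]], rule *[OF smooth_alg.mult[OF **]])
qed

lemma smooth_on_const: "smooth_on UNIV (\<lambda>x::real^'n. c)"
  using smooth_on_affine_coord[of 0 _ c] by simp

lemma smooth_on_cmult: "smooth_on UNIV f \<Longrightarrow> smooth_on UNIV (\<lambda>x. c * f x)"
  by (intro smooth_on_mult smooth_on_const)

lemma smooth_on_prod:
  "finite A \<Longrightarrow> (\<And>i. i \<in> A \<Longrightarrow> smooth_on UNIV (f i)) \<Longrightarrow> smooth_on UNIV (\<lambda>x. \<Prod>i\<in>A. f i x)"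
  by (induction A rule: finite_induct) (auto intro: smooth_on_mult smooth_on_const)

lemma partial_deriv_mult:
  assumes "smooth_on UNIV f" "smooth_on UNIV g"
  shows "partial_deriv i (\<lambda>x. f x * g x) x = f x * partial_deriv i g x + partial_deriv i f x * g x"
  using partial_deriv_eqI[OF has_derivative_mult[OF assms[THEN smooth_on_has_derivative]]]
  unfolding partial_deriv_def .

text \<open>Each differentiation contributes one factor \<open>a\<close>. With
  \<open>a = 1 / \<epsilon>\<close> this is the source of the negative powers of
  \<open>\<epsilon>\<close> in the scaling argument.\<close>

lemma iter_partial_scale:
  fixes f :: "real^'n \<Rightarrow> real"
  assumes f: "smooth_on UNIV f"
  shows "iter_partial js (\<lambda>x. f (a *\<^sub>R (x - c)))
    = (\<lambda>x. a ^ length js * iter_partial js f (a *\<^sub>R (x - c)))"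
proof (induction js)
  case (Cons i js)
  let ?g = "iter_partial js f"
  have g: "smooth_on UNIV ?g"
    using f by (rule smooth_on_iter_partial)
  have D: "((\<lambda>x. a ^ length js * ?g (a *\<^sub>R (x - c))) has_derivative
      (\<lambda>h. a ^ length js * frechet_derivative ?g (at (a *\<^sub>R (x - c))) (a *\<^sub>R h))) (at x)" for x
  proof -
    have "((\<lambda>x. a *\<^sub>R (x - c)) has_derivative (\<lambda>h. a *\<^sub>R h)) (at x)"
      by (auto intro!: derivative_eq_intros)
    from has_derivative_compose[OF this smooth_on_has_derivative[OF g]]
    show ?thesis by (rule has_derivative_mult_right)
  qed
  have "frechet_derivative ?g (at y) (a *\<^sub>R h) = a * frechet_derivative ?g (at y) h" for y h
    using linear_frechet_derivative[OF smooth_on_differentiable[OF g]]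
    by (simp add: linear_cmul)
  then show ?case
    by (simp add: Cons fun_eq_iff partial_deriv_eqI[OF D]) (simp add: partial_deriv_def)
qed simp

lemma smooth_on_scale:
  assumes "smooth_on UNIV f"
  shows "smooth_on UNIV (\<lambda>x. f (a *\<^sub>R (x - c)))"
  unfolding smooth_on_def iter_partial_scale[OF assms]
proof safe
  fix js and x :: "real^'a"
  have "(\<lambda>x. a *\<^sub>R (x - c)) differentiable (at x)"
    by simp
  moreover have "iter_partial js f differentiable (at (a *\<^sub>R (x - c)))"
    using assms smooth_on_def by blast
  ultimately show "(\<lambda>x. a ^ length js * iter_partial js f (a *\<^sub>R (x - c))) differentiable (at x)"
    by (intro differentiable_mult differentiable_const) (rule differentiable_compose)
qed

lemma partial_deriv_zero_outside:
  assumes "closed K" "\<And>x. x \<notin> K \<Longrightarrow> f x = 0" "x \<notin> K"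
  shows "partial_deriv i f x = 0"
proof -
  have "(f has_derivative (\<lambda>_. 0)) (at x)"
    using has_derivative_transform_within_open[of "\<lambda>_. 0" "\<lambda>_. 0" x UNIV "- K" f] assms by auto
  then show ?thesis by (rule partial_deriv_eqI)
qed

lemma iter_partial_zero_outside:
  assumes "closed K" "\<And>x. x \<notin> K \<Longrightarrow> f x = 0" "x \<notin> K"
  shows "iter_partial js f x = 0"
  using assms(3)
proof (induction js arbitrary: x)
  case (Cons i js)
  then show ?case
    using partial_deriv_zero_outside[OF assms(1)] by simp
qed (use assms in auto)

section \<open>Flat functions on the line and bumps on boxes\<close>

lemma poly_mult_exp_tendsto_0: "((\<lambda>y::real. poly p y * exp (- y)) \<longlongrightarrow> 0) at_top"
proof -
  have "((\<lambda>y::real. \<Sum>i\<le>degree p. coeff p i * (y ^ i / exp y)) \<longlongrightarrow> (\<Sum>i\<le>degree p. coeff p i * 0)) at_top"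
    by (intro tendsto_sum tendsto_mult_left tendsto_power_div_exp_0)
  then show ?thesis
    by (simp add: poly_altdef exp_minus divide_inverse sum_distrib_right mult.assoc)
qed

text \<open>For positive \<open>t\<close> the product and chain rules give
  \<open>(1 / t)^2 * (p - p') (1 / t) * exp (- (1 / t))\<close>, and \<open>[:0, 0, 1:]\<close> is
  the square of the variable. At 0 exponential decay beats polynomial growth. So functions of this
  form are closed under differentiation.\<close>

lemma flat_deriv:
  "((\<lambda>t::real. if t \<le> 0 then 0 else poly p (1 / t) * exp (- (1 / t))) has_real_derivative
     (if t \<le> 0 then 0 else poly ([:0, 0, 1:] * (p - pderiv p)) (1 / t) * exp (- (1 / t)))) (at t)"
  (is "(?f has_real_derivative _) _")
proof -
  consider "t < 0" | "t = 0" | "t > 0" by linarith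
  then show ?thesis
  proof cases
    case 1
    then show ?thesis
      by (auto intro!: has_field_derivative_transform_within_open[of "\<lambda>_. 0" 0 t "{..<0}" ?f])
  next
    case 3
    have "((\<lambda>t. poly p (1 / t) * exp (- (1 / t))) has_real_derivative
        (poly ([:0, 0, 1:] * (p - pderiv p)) (1 / t) * exp (- (1 / t)))) (at t)"
      using 3 by (auto intro!: derivative_eq_intros DERIV_chain2[OF poly_DERIV] simp: field_simps power2_eq_square)
    then show ?thesis
      using 3 by (auto intro!: has_field_derivative_transform_within_open[of
            "\<lambda>t. poly p (1 / t) * exp (- (1 / t))" _ t "{0<..}" ?f])
  next
    case 2
    have "((\<lambda>h. ?f h / h) \<longlongrightarrow> 0) (at_left 0)"
      by (rule tendsto_eventually) (auto simp: eventually_at_filter)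
    moreover have "((\<lambda>h. ?f h / h) \<longlongrightarrow> 0) (at_right 0)"
    proof (rule Lim_transform_eventually)
      \<comment> \<open>Substituting \<open>y = 1 / h\<close>, the division by \<open>h\<close>
        becomes a multiplication by \<open>y\<close>, hence the extra factor
        \<open>[:0, 1:]\<close>.\<close>
      show "((\<lambda>h. poly ([:0, 1:] * p) (inverse h) * exp (- inverse h)) \<longlongrightarrow> 0) (at_right (0::real))"
        by (rule filterlim_compose[OF poly_mult_exp_tendsto_0 filterlim_inverse_at_top_right])
      show "\<forall>\<^sub>F h in at_right 0. poly ([:0, 1:] * p) (inverse h) * exp (- inverse h) = ?f h / h"
        by (auto simp: eventually_at_filter field_simps)
    qed
    ultimately have "((\<lambda>h. ?f h / h) \<longlongrightarrow> 0) (at 0)"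
      by (simp add: filterlim_at_split)
    then show ?thesis
      unfolding DERIV_def 2 add_0 by simp
  qed
qed

text \<open>\<open>G 0\<close> is the classical \<open>exp (- (1 / t))\<close> extended by zero, and
  \<open>G l\<close> is its \<open>l\<close>-th derivative, found by iterating the polynomial
  recursion of \<open>flat_deriv\<close> from the constant 1.\<close>

lemma flat_function_exists:
  obtains G :: "nat \<Rightarrow> real \<Rightarrow> real"
  where "\<And>l t. (G l has_real_derivative G (Suc l) t) (at t)"
    and "\<And>t. G 0 t > 0 \<longleftrightarrow> t > 0" and "\<And>t. G 0 t \<ge> 0"
proof
  define P where "P l = ((\<lambda>p. [:0, 0, 1:] * (p - pderiv p)) ^^ l) [:1::real:]" for l
  define G where "G l t = (if t \<le> 0 then 0 else poly (P l) (1 / t) * exp (- (1 / t)))" for l t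
  show "(G l has_real_derivative G (Suc l) t) (at t)" for l t
    using flat_deriv[of "P l" t] unfolding G_def[abs_def] P_def funpow.simps(2) o_apply .
  show "G 0 t > 0 \<longleftrightarrow> t > 0" "G 0 t \<ge> 0" for t
    by (auto simp: G_def P_def)
qed

lemma box_bump_exists:
  fixes a b :: "real^'n"
  obtains \<phi> where "smooth_on UNIV \<phi>" "\<And>x. \<phi> x \<ge> 0" "\<And>x. \<phi> x > 0 \<longleftrightarrow> x \<in> box a b"
proof -
  obtain G :: "nat \<Rightarrow> real \<Rightarrow> real" where G: "\<And>l t. (G l has_real_derivative G (Suc l) t) (at t)"
    and pos: "\<And>t. G 0 t > 0 \<longleftrightarrow> t > 0" and nn: "\<And>t. G 0 t \<ge> 0"
    by (rule flat_function_exists) blast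
  \<comment> \<open>Each coordinate contributes one flat factor per face of the box, so the product
    is nonzero exactly when \<open>x\<close> lies strictly between all pairs of faces. The arguments
    are spelled to match \<open>smooth_on_affine_coord\<close>.\<close>
  define \<phi> where "\<phi> x = (\<Prod>i\<in>UNIV. G 0 (1 * x $ i + - a $ i) * G 0 (- 1 * x $ i + b $ i))" for x
  show ?thesis
  proof
    show "smooth_on UNIV \<phi>"
      unfolding \<phi>_def[abs_def]
      by (intro smooth_on_prod smooth_on_mult smooth_on_compose[where G = G, OF G]
          smooth_on_affine_coord finite)
    show nn': "\<phi> x \<ge> 0" for x
      unfolding \<phi>_def by (intro prod_nonneg mult_nonneg_nonneg nn ballI)
    have "\<phi> x \<noteq> 0 \<longleftrightarrow> x \<in> box a b" for x
    proof -
      have "\<phi> x \<noteq> 0 \<longleftrightarrow> (\<forall>i. G 0 (x $ i - a $ i) > 0 \<and> G 0 (b $ i - x $ i) > 0)"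
        using nn by (auto simp: \<phi>_def order_less_le)
      then show ?thesis
        by (simp add: pos mem_box_cart)
    qed
    then show "\<phi> x > 0 \<longleftrightarrow> x \<in> box a b" for x
      using nn'[of x] by (auto simp: order_less_le)
  qed
qed

section \<open>Integration by parts\<close>

text \<open>\<open>K\<close> is any compact set containing the support, not the support itself. It
  can thus be kept unchanged when passing to derivatives and products.\<close>

definition smooth_supported :: "(real^'n) set \<Rightarrow> (real^'n \<Rightarrow> real) \<Rightarrow> bool" where
  "smooth_supported K f \<longleftrightarrow> smooth_on UNIV f \<and> compact K \<and> (\<forall>x. x \<notin> K \<longrightarrow> f x = 0)"

lemma test_functions_iff:
  "f \<in> test_functions \<Omega> \<longleftrightarrow> (\<exists>K\<subseteq>\<Omega>. smooth_supported K f)"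
proof
  assume "f \<in> test_functions \<Omega>"
  then show "\<exists>K\<subseteq>\<Omega>. smooth_supported K f"
    using closure_subset[of "{x. f x \<noteq> 0}"]
    by (intro exI[of _ "closure {x. f x \<noteq> 0}"])
      (auto simp: test_functions_def smooth_supported_def)
next
  assume "\<exists>K\<subseteq>\<Omega>. smooth_supported K f"
  then obtain K where K: "K \<subseteq> \<Omega>" "smooth_supported K f" by blast
  then have "closure {x. f x \<noteq> 0} \<subseteq> K"
    by (intro closure_minimal) (auto simp: smooth_supported_def compact_imp_closed)
  then show "f \<in> test_functions \<Omega>"
    using K compact_Int_closed[of K "closure {x. f x \<noteq> 0}"]
    by (auto simp: smooth_supported_def test_functions_def Int_absorb1)
qed

lemma smooth_supported_iter_partial:
  "smooth_supported K f \<Longrightarrow> smooth_supported K (iter_partial js f)"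
  unfolding smooth_supported_def
  by (metis compact_imp_closed iter_partial_zero_outside smooth_on_iter_partial)

lemma smooth_supported_partial_deriv:
  "smooth_supported K f \<Longrightarrow> smooth_supported K (partial_deriv i f)"
  using smooth_supported_iter_partial[of K f "[i]"] by simp

lemma smooth_supported_mult:
  "smooth_on UNIV f \<Longrightarrow> smooth_supported K g \<Longrightarrow> smooth_supported K (\<lambda>x. f x * g x)"
  by (simp add: smooth_supported_def smooth_on_mult)

lemma smooth_on_borel_measurable:
  "smooth_on UNIV f \<Longrightarrow> f \<in> borel_measurable borel"
  by (intro borel_measurable_continuous_onI smooth_on_continuous_on)

lemma smooth_supported_bounded:
  assumes "smooth_supported K f"
  obtains M where "M > 0" "\<And>x. \<bar>f x\<bar> \<le> M"
proof -
  have "compact (f ` K)"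
    using assms smooth_on_continuous_on[of UNIV f] continuous_on_subset
    by (intro compact_continuous_image) (auto simp: smooth_supported_def)
  then obtain M where "M > 0" "\<forall>y\<in>f ` K. norm y \<le> M"
    using bounded_pos compact_imp_bounded by metis
  then show ?thesis
    using assms that[of M] by (force simp: smooth_supported_def)
qed

lemma smooth_supported_integrable:
  assumes "smooth_supported K f"
  shows "integrable lborel f"
proof -
  have "integrable lborel (\<lambda>x. indicator K x *\<^sub>R f x)"
    using assms smooth_on_continuous_on[of UNIV f] continuous_on_subset
    by (intro borel_integrable_compact) (auto simp: smooth_supported_def)
  also have "(\<lambda>x. indicator K x *\<^sub>R f x) = f"
    using assms by (auto simp: smooth_supported_def indicator_def fun_eq_iff)
  finally show ?thesis .
qed

lemma integral_lborel_affine: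
  fixes f :: "'a::euclidean_space \<Rightarrow> real"
  assumes [measurable]: "f \<in> borel_measurable borel" and "c \<noteq> 0"
  shows "integral\<^sup>L lborel f = \<bar>c\<bar> ^ DIM('a) * (\<integral>x. f (t + c *\<^sub>R x) \<partial>lborel)"
  by (subst lborel_affine[OF \<open>c \<noteq> 0\<close>, of t], subst integral_density)
    (auto simp: integral_distr)

lemma partial_deriv_along_line:
  assumes "smooth_on UNIV f"
  shows "((\<lambda>t. f (x + t *\<^sub>R axis i 1)) has_real_derivative partial_deriv i f (x + t *\<^sub>R axis i 1)) (at t)"
proof -
  let ?y = "x + t *\<^sub>R axis i 1"
  have "((\<lambda>t. x + t *\<^sub>R axis i 1) has_derivative (\<lambda>h. h *\<^sub>R axis i 1)) (at t)"
    by (auto intro!: derivative_eq_intros)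
  from has_derivative_compose[OF this smooth_on_has_derivative[OF assms]]
  have "((\<lambda>t. f (x + t *\<^sub>R axis i 1)) has_derivative
      (\<lambda>h. frechet_derivative f (at ?y) (h *\<^sub>R axis i 1))) (at t)" .
  moreover have "frechet_derivative f (at ?y) (h *\<^sub>R axis i 1) = partial_deriv i f ?y * h" for h
    using linear_frechet_derivative[OF smooth_on_differentiable[OF assms]]
    by (simp add: linear_cmul partial_deriv_def mult.commute)
  ultimately show ?thesis
    by (simp add: has_field_derivative_def)
qed

text \<open>Difference quotients have integral zero by translation invariance, and they converge
  dominatedly.\<close>

lemma integral_partial_deriv_eq_0:
  fixes f :: "real^'n \<Rightarrow> real"
  assumes f: "smooth_supported K f"
  shows "(\<integral>x. partial_deriv i f x \<partial>lborel) = 0"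
proof -
  let ?e = "axis i 1 :: real^'n"
  have smooth: "smooth_on UNIV f" and K: "compact K" "\<And>x. x \<notin> K \<Longrightarrow> f x = 0"
    using f by (auto simp: smooth_supported_def)
  have [measurable]: "f \<in> borel_measurable borel" "partial_deriv i f \<in> borel_measurable borel"
    using smooth smooth_on_partial_deriv smooth_on_borel_measurable by blast+
  obtain M where M: "M > 0" "\<And>x. \<bar>partial_deriv i f x\<bar> \<le> M"
    using smooth_supported_bounded[OF smooth_supported_partial_deriv[OF f]] by blast
  obtain R where R: "\<And>x. x \<in> K \<Longrightarrow> norm x \<le> R"
    using compact_imp_bounded[OF K(1)] unfolding bounded_iff by blast
  define h where "h l = 1 / real (Suc l)" for l
  define s where "s l x = (f (x + h l *\<^sub>R ?e) - f x) / h l" for l x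
  have h: "0 < h l" "h l \<le> 1" for l by (auto simp: h_def)
  have h0: "h \<longlonglongrightarrow> 0"
    unfolding h_def using lim_1_over_n by (rule LIMSEQ_Suc)
  \<comment> \<open>Since \<open>h l \<le> 1\<close>, the quotient vanishes outside the ball of
    radius \<open>R + 1\<close>; inside, the mean value theorem bounds it by \<open>M\<close>. This
    gives the dominating function.\<close>
  have "(\<lambda>l. integral\<^sup>L lborel (s l)) \<longlonglongrightarrow> (\<integral>x. partial_deriv i f x \<partial>lborel)"
  proof (rule integral_dominated_convergence[where w = "\<lambda>x. M * indicator (cball 0 (R + 1)) x"])
    show "integrable lborel (\<lambda>x. M * indicator (cball 0 (R + 1)) x)"
      by (intro integrable_mult_right integrable_real_indicator)
        (simp_all add: emeasure_lborel_cball_finite[unfolded infinity_ennreal_def])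
    show "AE x in lborel. (\<lambda>l. s l x) \<longlonglongrightarrow> partial_deriv i f x"
    proof
      fix x
      have "((\<lambda>k. (f (x + k *\<^sub>R ?e) - f x) / k) \<longlongrightarrow> partial_deriv i f x) (at 0)"
        using partial_deriv_along_line[OF smooth, of x i 0] by (simp add: DERIV_def)
      then show "(\<lambda>l. s l x) \<longlonglongrightarrow> partial_deriv i f x"
        unfolding s_def by (rule filterlim_compose)
          (use h h0 in \<open>auto simp: filterlim_at less_imp_neq[symmetric]\<close>)
    qed
    show "AE x in lborel. norm (s l x) \<le> M * indicator (cball 0 (R + 1)) x" for l
    proof
      fix x
      show "norm (s l x) \<le> M * indicator (cball 0 (R + 1)) x"
      proof (cases "x \<in> cball 0 (R + 1)")
        case True
        obtain z where "f (x + h l *\<^sub>R ?e) - f (x + 0 *\<^sub>R ?e)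
            = (h l - 0) * partial_deriv i f (x + z *\<^sub>R ?e)"
          using MVT2[of 0 "h l" "\<lambda>t. f (x + t *\<^sub>R ?e)", OF h(1)
              partial_deriv_along_line[OF smooth]] by blast
        then have "s l x = partial_deriv i f (x + z *\<^sub>R ?e)"
          using h(1)[of l] by (simp add: s_def)
        then show ?thesis
          using True M(2) by simp
      next
        case False
        have "norm x \<le> norm (x + h l *\<^sub>R ?e) + norm (h l *\<^sub>R ?e)"
          by (metis add_diff_cancel_right' norm_triangle_ineq4)
        also have "norm (h l *\<^sub>R ?e) = h l"
          using h(1)[of l] by (simp add: norm_axis_1)
        finally have "R < norm (x + h l *\<^sub>R ?e)" "R < norm x"
          using False h(2)[of l] by auto
        then have "x + h l *\<^sub>R ?e \<notin> K" "x \<notin> K"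
          using R linorder_not_less by blast+
        then show ?thesis
          using False K(2) by (simp add: s_def)
      qed
    qed
  qed (simp_all add: s_def[abs_def])
  moreover have "integral\<^sup>L lborel (s l) = 0" for l
  proof -
    have int: "integrable lborel f"
      using f by (rule smooth_supported_integrable)
    have eq: "distr lborel borel ((+) (h l *\<^sub>R ?e)) = lborel"
      by (rule lborel_distr_plus)
    have "integrable lborel (\<lambda>x. f (h l *\<^sub>R ?e + x))"
      using int by (subst (asm) eq[symmetric]) (simp add: integrable_distr_eq)
    moreover have "(\<integral>x. f (h l *\<^sub>R ?e + x) \<partial>lborel) = integral\<^sup>L lborel f"
      by (subst (2) eq[symmetric]) (simp add: integral_distr)
    ultimately show ?thesis
      using int by (simp add: s_def[abs_def] add.commute)
  qed
  ultimately show ?thesis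
    by (simp add: LIMSEQ_const_iff)
qed

lemma integral_by_parts:
  assumes f: "smooth_on UNIV f" and g: "smooth_supported K g"
  shows "(\<integral>x. f x * partial_deriv i g x \<partial>lborel) = - (\<integral>x. partial_deriv i f x * g x \<partial>lborel)"
proof -
  have "integrable lborel (\<lambda>x. f x * partial_deriv i g x)"
    "integrable lborel (\<lambda>x. partial_deriv i f x * g x)"
    using smooth_supported_integrable smooth_supported_mult smooth_supported_partial_deriv
      smooth_on_partial_deriv f g by blast+
  moreover have "(\<integral>x. f x * partial_deriv i g x + partial_deriv i f x * g x \<partial>lborel) = 0"
    using integral_partial_deriv_eq_0[OF smooth_supported_mult[OF f g], of i] f g
    by (simp add: partial_deriv_mult smooth_supported_def)
  ultimately show ?thesis
    by simp
qed

text \<open>Each integration by parts takes the outermost derivative off \<open>g\<close> and makes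
  it the innermost one on \<open>f\<close>. This is the reason for \<open>rev js\<close>.\<close>

lemma integral_by_parts_iterated:
  assumes "smooth_on UNIV f" and g: "smooth_supported K g"
  shows "(\<integral>x. f x * iter_partial js g x \<partial>lborel)
    = (- 1) ^ length js * (\<integral>x. iter_partial (rev js) f x * g x \<partial>lborel)"
  using assms(1)
proof (induction js arbitrary: f)
  case (Cons i js)
  then show ?case
    using integral_by_parts[OF Cons.prems smooth_supported_iter_partial[OF g], of i js]
      Cons.IH[OF smooth_on_partial_deriv[OF Cons.prems], of i]
    by (simp add: iter_partial_append)
qed simp

section \<open>Classical derivatives as weak derivatives\<close>

lemma integral_against_supported:
  assumes "u \<in> borel_measurable borel" "smooth_supported K \<phi>" "K \<subseteq> \<Omega>"
  shows "(LINT x:\<Omega>|lebesgue. u x * \<phi> x) = (\<integral>x. u x * \<phi> x \<partial>lborel)"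
proof -
  have "(LINT x:\<Omega>|lebesgue. u x * \<phi> x) = (\<integral>x. u x * \<phi> x \<partial>lebesgue)"
    unfolding set_lebesgue_integral_def
    using assms(2,3) by (intro Bochner_Integration.integral_cong)
      (auto simp: smooth_supported_def indicator_def)
  also have "\<dots> = (\<integral>x. u x * \<phi> x \<partial>lborel)"
    using assms smooth_on_borel_measurable[of \<phi>]
    by (intro integral_completion) (auto simp: smooth_supported_def)
  finally show ?thesis .
qed

lemma locally_integrable_continuous:
  assumes "continuous_on \<Omega> f"
  shows "locally_integrable \<Omega> f"
  unfolding locally_integrable_def
proof safe
  fix K assume "compact K" "K \<subseteq> \<Omega>"
  then have "integrable lborel (\<lambda>x. indicator K x *\<^sub>R f x)"
    using assms continuous_on_subset by (intro borel_integrable_compact) auto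
  then show "f absolutely_integrable_on K"
    unfolding set_integrable_def by (subst integrable_completion) auto
qed

lemma has_weak_deriv_smooth:
  assumes u: "smooth_on UNIV u"
  shows "has_weak_deriv \<Omega> js u (iter_partial (rev js) u)"
proof -
  have "locally_integrable \<Omega> v" if "smooth_on UNIV v" for v :: "real^'a \<Rightarrow> real"
    using that smooth_on_continuous_on continuous_on_subset
    by (blast intro: locally_integrable_continuous)
  moreover have "(LINT x:\<Omega>|lebesgue. u x * iter_partial js \<phi> x)
      = (- 1) ^ length js * (LINT x:\<Omega>|lebesgue. iter_partial (rev js) u x * \<phi> x)"
    if "\<phi> \<in> test_functions \<Omega>" for \<phi>
  proof -
    obtain K where K: "K \<subseteq> \<Omega>" "smooth_supported K \<phi>"
      using \<open>\<phi> \<in> test_functions \<Omega>\<close> test_functions_iff by blast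
    have "u \<in> borel_measurable borel" "iter_partial (rev js) u \<in> borel_measurable borel"
      using u smooth_on_iter_partial smooth_on_borel_measurable by blast+
    then show ?thesis
      using K smooth_supported_iter_partial[OF K(2)] integral_by_parts_iterated[OF u K(2)]
      by (simp add: integral_against_supported[where K = K])
  qed
  ultimately show ?thesis
    using u smooth_on_iter_partial unfolding has_weak_deriv_def by blast
qed

section \<open>Uniqueness of weak derivatives\<close>

lemma smooth_on_exp:
  assumes "smooth_on UNIV f"
  shows "smooth_on UNIV (\<lambda>x. exp (c * f x))"
proof -
  have "((\<lambda>t. c ^ l * exp (c * t)) has_real_derivative c ^ Suc l * exp (c * t)) (at t)" for l t
    by (auto intro!: derivative_eq_intros)
  from smooth_on_compose[of "\<lambda>l t. c ^ l * exp (c * t)", OF this assms, of 0]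
  show ?thesis by simp
qed

text \<open>The functions \<open>1 - exp (- l \<phi>)\<close>, with \<open>\<phi>\<close> a bump positive exactly on the box, are test functions
  increasing to the indicator function of the box.\<close>

lemma integral_box_eq_0:
  fixes f :: "real^'n \<Rightarrow> real"
  assumes f: "locally_integrable \<Omega> f"
    and orth: "\<And>\<phi>. \<phi> \<in> test_functions \<Omega> \<Longrightarrow> (LINT x:\<Omega>|lebesgue. f x * \<phi> x) = 0"
    and sub: "cbox a b \<subseteq> \<Omega>"
  shows "(LINT x:box a b|lebesgue. f x) = 0"
proof -
  obtain \<phi> :: "real^'n \<Rightarrow> real" where smooth: "smooth_on UNIV \<phi>" and nn: "\<And>x. \<phi> x \<ge> 0"
    and pos: "\<And>x. \<phi> x > 0 \<longleftrightarrow> x \<in> box a b"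
    by (rule box_bump_exists[of a b]) blast
  define \<eta> where "\<eta> l x = 1 + - 1 * exp (- real l * \<phi> x)" for l x
  have \<eta>: "smooth_supported (cbox a b) (\<eta> l)" for l
    unfolding smooth_supported_def
  proof (intro conjI allI impI)
    show "smooth_on UNIV (\<eta> l)"
      unfolding \<eta>_def[abs_def]
      by (intro smooth_on_add smooth_on_cmult smooth_on_const smooth_on_exp smooth)
    fix x assume "x \<notin> cbox a b"
    then have "\<phi> x = 0"
      using nn[of x] pos[of x] box_subset_cbox[of a b] by (auto simp: order_less_le)
    then show "\<eta> l x = 0"
      by (simp add: \<eta>_def)
  qed auto
  have [measurable]: "\<eta> l \<in> borel_measurable borel" for l
    using \<eta> smooth_on_borel_measurable smooth_supported_def by blast
  have int: "integrable lebesgue (\<lambda>x. indicator (cbox a b) x * f x)"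
    using f sub unfolding locally_integrable_def set_integrable_def by simp
  then have meas: "(\<lambda>x. indicator (cbox a b) x * f x) \<in> borel_measurable lebesgue"
    by simp
  have [measurable]: "\<eta> l \<in> borel_measurable lebesgue" for l
    by (rule measurable_completion) simp
  \<comment> \<open>\<open>f\<close> is known to be integrable only on compact subsets of
    \<open>\<Omega>\<close>, so every integrand is rewritten with the factor
    \<open>indicator (cbox a b) x * f x\<close>, which also serves as dominating function.\<close>
  have cut: "indicator \<Omega> x *\<^sub>R (f x * \<eta> l x) = (indicator (cbox a b) x * f x) * \<eta> l x" for l x
    using \<eta>[of l] sub by (auto simp: indicator_def smooth_supported_def)
  have cut': "indicator (box a b) x *\<^sub>R f x = (indicator (cbox a b) x * f x) * indicator (box a b) x" for x
    using box_subset_cbox[of a b] by (auto simp: indicator_def)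
  have "(\<lambda>l. LINT x|lebesgue. (indicator (cbox a b) x * f x) * \<eta> l x)
      \<longlonglongrightarrow> (LINT x|lebesgue. (indicator (cbox a b) x * f x) * indicator (box a b) x)"
  proof (rule integral_dominated_convergence[where w = "\<lambda>x. \<bar>indicator (cbox a b) x * f x\<bar>"])
    show "integrable lebesgue (\<lambda>x. \<bar>indicator (cbox a b) x * f x\<bar>)"
      using int by (rule integrable_abs)
    show "AE x in lebesgue. (\<lambda>l. indicator (cbox a b) x * f x * \<eta> l x)
        \<longlonglongrightarrow> indicator (cbox a b) x * f x * indicator (box a b) x"
    proof (intro AE_I2 tendsto_mult_left)
      fix x
      show "(\<lambda>l. \<eta> l x) \<longlonglongrightarrow> indicator (box a b) x"
      proof (cases "x \<in> box a b")
        case True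
        have "(\<lambda>l. exp (- \<phi> x) ^ l) \<longlonglongrightarrow> 0"
          using True pos by (intro LIMSEQ_realpow_zero) auto
        then have "(\<lambda>l. 1 + - 1 * exp (- \<phi> x) ^ l) \<longlonglongrightarrow> 1 + - 1 * 0"
          by (intro tendsto_add tendsto_mult tendsto_const)
        then show ?thesis
          using True by (simp add: \<eta>_def exp_of_nat_mult[symmetric])
      next
        case False
        then have "\<phi> x = 0"
          using nn[of x] pos[of x] by (auto simp: order_less_le)
        then show ?thesis
          using False by (simp add: \<eta>_def)
      qed
    qed
    show "AE x in lebesgue. norm (indicator (cbox a b) x * f x * \<eta> l x)
        \<le> \<bar>indicator (cbox a b) x * f x\<bar>" for l
    proof (rule AE_I2)
      fix x
      have "\<bar>\<eta> l x\<bar> \<le> 1"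
        using nn[of x] by (auto simp: \<eta>_def)
      then show "norm (indicator (cbox a b) x * f x * \<eta> l x) \<le> \<bar>indicator (cbox a b) x * f x\<bar>"
        by (simp add: abs_mult mult_left_le)
    qed
  qed (intro borel_measurable_times[OF meas] borel_measurable_indicator; simp)+
  moreover have "(LINT x|lebesgue. (indicator (cbox a b) x * f x) * \<eta> l x) = 0" for l
  proof -
    have "\<eta> l \<in> test_functions \<Omega>"
      using \<eta> sub test_functions_iff by blast
    from orth[OF this] show ?thesis
      by (simp only: set_lebesgue_integral_def cut)
  qed
  ultimately show ?thesis
    by (simp only: set_lebesgue_integral_def cut') (simp add: LIMSEQ_const_iff)
qed

text \<open>Boxes form an intersection-stable generator of the Borel sets, so a Dynkin class
  argument carries the vanishing of the integrals to all Borel sets; \<open>total\<close> takes care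
  of complements. A density with all these integrals zero vanishes almost everywhere.\<close>

lemma AE_0_of_box_integrals:
  fixes F :: "real^'n \<Rightarrow> real"
  assumes F: "integrable lebesgue F" and total: "integral\<^sup>L lebesgue F = 0"
    and box: "\<And>a b. (LINT x:box a b|lebesgue. F x) = 0"
  shows "AE x in lebesgue. F x = 0"
proof -
  \<comment> \<open>The argument runs on Borel sets, so \<open>F\<close> is replaced by an almost
    everywhere equal Borel function and the result is carried back at the end.\<close>
  obtain g where g[measurable]: "g \<in> borel_measurable lborel" and "AE x in lborel. F x = g x"
    using completion_ex_borel_measurable_real[of F lborel] F by auto
  then have ae: "AE x in lebesgue. F x = g x"
    by (simp add: AE_completion_iff)
  have [measurable]: "g \<in> borel_measurable lebesgue" "F \<in> borel_measurable lebesgue"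
    using F measurable_completion[OF g] by auto
  have "integrable lebesgue g"
    using integrable_cong_AE_imp[OF F _ ae] by simp
  then have int: "integrable lborel g"
    using integrable_completion[OF g] by simp
  have eq: "(LINT x:A|lborel. g x) = (LINT x:A|lebesgue. F x)" if [measurable]: "A \<in> sets borel" for A
  proof -
    have [measurable]: "A \<in> sets lebesgue"
      using that by simp
    have "(LINT x:A|lborel. g x) = (LINT x:A|lebesgue. g x)"
      unfolding set_lebesgue_integral_def by (rule integral_completion[symmetric]) measurable
    also have "\<dots> = (LINT x:A|lebesgue. F x)"
      unfolding set_lebesgue_integral_def
      by (intro integral_cong_AE) (use ae in auto)
    finally show ?thesis .
  qed
  have *: "(LINT x:A|lborel. g x) = 0" if "A \<in> sets lborel" for A
  proof -
    have stable: "Int_stable (range (\<lambda>(a, b). box a b :: (real^'n) set))"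
      by (auto simp: Int_stable_def box_Int_box)
    have A: "A \<in> sigma_sets UNIV (range (\<lambda>(a, b). box a b))"
      using that by (simp add: borel_eq_box)
    have sets: "B \<in> sets lborel" if "B \<in> sigma_sets UNIV (range (\<lambda>(a, b). box a b))" for B :: "(real^'n) set"
      using that by (simp add: borel_eq_box)
    have set_int: "set_integrable lborel B g" if "B \<in> sets lborel" for B
      using integrable_mult_indicator[OF that int] by (simp add: set_integrable_def)
    have UNIV: "(LINT x:UNIV|lborel. g x) = 0"
      using eq[of UNIV] total by (simp add: set_lebesgue_integral_def)
    have "range (\<lambda>(a, b). box a b :: (real^'n) set) \<subseteq> Pow UNIV"
      by simp
    with stable show ?thesis
      using A
    proof (induction A rule: sigma_sets_induct_disjoint)
      case (compl A)
      have "(LINT x:A \<union> (UNIV - A)|lborel. g x) = (LINT x:A|lborel. g x) + (LINT x:UNIV - A|lborel. g x)"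
        using sets[OF compl(1)] by (intro set_integral_Un set_int) auto
      then show ?case
        using UNIV compl by simp
    next
      case (union A)
      have "(LINT x:(\<Union>i. A i)|lborel. g x) = (\<Sum>i. (LINT x:(A i)|lborel. g x))"
      proof (rule lebesgue_integral_countable_add)
        show A: "A i \<in> sets lborel" for i
          using union(2) by (intro sets) auto
        show "set_integrable lborel (\<Union>i. A i) g"
          using A by (intro set_int sets.countable_UN) auto
      qed (use union(1) in \<open>auto simp: disjoint_family_on_def\<close>)
      then show ?case
        using union by simp
    next
      case empty
      show ?case
        by (simp add: set_lebesgue_integral_def)
    qed (use box eq in auto)
  qed
  have "AE x in lborel. g x = 0"
    using density_unique_real[OF int integrable_zero] * by simp
  then have "AE x in lebesgue. g x = 0"
    by (simp add: AE_completion_iff)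
  with ae show ?thesis
    by eventually_elim simp
qed

text \<open>On a closed box inside \<open>\<Omega>\<close>, cut \<open>f\<close> down to the
  interior of the box. The cut function integrates to zero over every box, because two boxes meet in
  a box, and hence vanishes almost everywhere. Countably many closed boxes cover
  \<open>\<Omega>\<close>.\<close>

lemma fundamental_lemma_calculus_of_variations:
  fixes f :: "real^'n \<Rightarrow> real"
  assumes "open \<Omega>" and f: "locally_integrable \<Omega> f"
    and orth: "\<And>\<phi>. \<phi> \<in> test_functions \<Omega> \<Longrightarrow> (LINT x:\<Omega>|lebesgue. f x * \<phi> x) = 0"
  shows "AE x in lebesgue. x \<in> \<Omega> \<longrightarrow> f x = 0"
proof -
  have cbox: "AE x in lebesgue. x \<in> cbox a b \<longrightarrow> f x = 0" if sub: "cbox a b \<subseteq> \<Omega>" for a b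
  proof -
    define F where "F x = indicator (box a b) x * f x" for x
    have int: "integrable lebesgue (\<lambda>x. indicator (cbox a b) x *\<^sub>R f x)"
      using f sub unfolding locally_integrable_def set_integrable_def by simp
    have eq: "F x = indicator (box a b) x *\<^sub>R (indicator (cbox a b) x *\<^sub>R f x)" for x
      using box_subset_cbox[of a b] by (auto simp: F_def indicator_def)
    have "integrable lebesgue F"
      unfolding eq[abs_def] by (rule integrable_mult_indicator[OF _ int]) simp
    moreover have "integral\<^sup>L lebesgue F = 0"
      using integral_box_eq_0[OF f orth sub] by (simp add: F_def[abs_def] set_lebesgue_integral_def)
    moreover have "(LINT x:box c d|lebesgue. F x) = 0" for c d
    proof -
      obtain e g where eg: "box c d \<inter> box a b = box e g"
        using box_Int_box by blast
      have "(LINT x:box c d|lebesgue. F x) = (LINT x:box e g|lebesgue. f x)"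
        unfolding set_lebesgue_integral_def F_def eg[symmetric]
        by (intro Bochner_Integration.integral_cong) (auto simp: indicator_def)
      \<comment> \<open>\<open>integral_box_eq_0\<close> asks for the closed box to lie in
        \<open>\<Omega>\<close>. Taking closures gives this for a nonempty intersection; an empty
        one has integral zero anyway.\<close>
      also have "\<dots> = 0"
      proof (cases "box e g = {}")
        case False
        then have "cbox e g \<subseteq> cbox a b"
          using closure_mono[of "box e g" "box a b"] eg closure_box by (metis Int_lower2 closure_empty subset_empty)
        then show ?thesis
          using integral_box_eq_0[OF f orth] sub by blast
      qed (simp add: set_lebesgue_integral_def)
      finally show ?thesis .
    qed
    ultimately have "AE x in lebesgue. F x = 0"
      by (rule AE_0_of_box_integrals)
    \<comment> \<open>\<open>F\<close> carries no information about \<open>f\<close> on the faces of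
      the box, but these form a null set.\<close>
    moreover have "AE x in lebesgue. x \<notin> cbox a b - box a b"
      using negligible_frontier_interval[of a b] by (intro AE_not_in) (simp add: negligible_iff_null_sets)
    ultimately show ?thesis
      by eventually_elim (auto simp: F_def)
  qed
  obtain \<D> where \<D>: "countable \<D>" "\<D> \<subseteq> Pow \<Omega>" "\<And>X. X \<in> \<D> \<Longrightarrow> \<exists>a b. X = cbox a b" "\<Union>\<D> = \<Omega>"
    using open_countable_Union_open_cbox[OF \<open>open \<Omega>\<close>] by metis
  have "AE x in lebesgue. x \<in> X \<longrightarrow> f x = 0" if "X \<in> \<D>" for X
    using cbox \<D>(2,3) that by blast
  then have "AE x in lebesgue. \<forall>X\<in>\<D>. x \<in> X \<longrightarrow> f x = 0"
    by (subst AE_ball_countable[OF \<D>(1)]) blast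
  then show ?thesis
    by eventually_elim (use \<D>(4) in blast)
qed

lemma weak_deriv_unique:
  assumes "open \<Omega>" and v: "has_weak_deriv \<Omega> js u v" and w: "has_weak_deriv \<Omega> js u w"
  shows "AE x in lebesgue. x \<in> \<Omega> \<longrightarrow> v x = w x"
proof -
  have loc: "locally_integrable \<Omega> v" "locally_integrable \<Omega> w"
    using v w by (auto simp: has_weak_deriv_def)
  have "(LINT x:\<Omega>|lebesgue. (v x - w x) * \<phi> x) = 0" if \<phi>: "\<phi> \<in> test_functions \<Omega>" for \<phi>
  proof -
    obtain K where K: "K \<subseteq> \<Omega>" "smooth_supported K \<phi>"
      using \<phi> test_functions_iff by blast
    obtain M where M: "\<And>x. \<bar>\<phi> x\<bar> \<le> M"
      using smooth_supported_bounded[OF K(2)] by blast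
    have meas: "\<phi> \<in> borel_measurable lebesgue"
      using K(2) smooth_on_borel_measurable measurable_completion
      by (metis measurable_lborel2 smooth_supported_def)
    \<comment> \<open>Integrability of each product is required to split the integral of the
      difference. It holds because \<open>\<phi>\<close> is bounded and lives on the compact set
      \<open>K\<close>, where \<open>g\<close> is integrable.\<close>
    have int: "set_integrable lebesgue \<Omega> (\<lambda>x. g x * \<phi> x)" if "locally_integrable \<Omega> g" for g
    proof -
      have g: "integrable lebesgue (\<lambda>x. indicator K x *\<^sub>R g x)"
        using that K unfolding locally_integrable_def set_integrable_def smooth_supported_def by simp
      have "integrable lebesgue (\<lambda>x. \<phi> x * (indicator K x *\<^sub>R g x))"
      proof (rule Bochner_Integration.integrable_bound[OF integrable_mult_right[OF g, of M]])
        have "\<bar>\<phi> x\<bar> \<le> \<bar>M\<bar>" for x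
          using M[of x] by linarith
        then show "AE x in lebesgue. norm (\<phi> x * (indicator K x *\<^sub>R g x)) \<le> norm (M * (indicator K x *\<^sub>R g x))"
          by (auto simp: abs_mult intro!: mult_right_mono)
      qed (use g meas in auto)
      also have "(\<lambda>x. \<phi> x * (indicator K x *\<^sub>R g x)) = (\<lambda>x. indicator \<Omega> x *\<^sub>R (g x * \<phi> x))"
        using K by (auto simp: fun_eq_iff indicator_def smooth_supported_def)
      finally show ?thesis
        by (simp add: set_integrable_def)
    qed
    have "(LINT x:\<Omega>|lebesgue. v x * \<phi> x) = (LINT x:\<Omega>|lebesgue. w x * \<phi> x)"
      using v[unfolded has_weak_deriv_def] w[unfolded has_weak_deriv_def] \<phi> by simp
    then show ?thesis
      using loc[THEN int] by (simp add: left_diff_distrib set_integral_diff)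
  qed
  moreover have "locally_integrable \<Omega> (\<lambda>x. v x - w x)"
    using loc unfolding locally_integrable_def by (simp add: set_integral_diff(1))
  ultimately have "AE x in lebesgue. x \<in> \<Omega> \<longrightarrow> v x - w x = 0"
    using fundamental_lemma_calculus_of_variations[OF \<open>open \<Omega>\<close>] by blast
  then show ?thesis
    by simp
qed

text \<open>The choice operator in \<open>weak_deriv\<close> yields an unspecified weak derivative;
  uniqueness identifies it, up to a null set, with the classical one.\<close>

lemma weak_deriv_smooth:
  assumes "open \<Omega>" "smooth_on UNIV u"
  shows "AE x in lebesgue. x \<in> \<Omega> \<longrightarrow> weak_deriv \<Omega> js u x = iter_partial (rev js) u x"
proof (cases "js = []")
  case False
  have "has_weak_deriv \<Omega> js u (weak_deriv \<Omega> js u)"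
    using False someI[of "has_weak_deriv \<Omega> js u", OF has_weak_deriv_smooth[OF assms(2)]]
    by (simp add: weak_deriv_def)
  then show ?thesis
    using weak_deriv_unique[OF assms(1)] has_weak_deriv_smooth[OF assms(2)] by blast
qed (simp add: weak_deriv_def)

section \<open>Norm estimates\<close>

text \<open>\<open>f\<close> is constant along every line in direction \<open>i\<close>, and each
  such line leaves the compact set \<open>K\<close>. The value \<open>t\<close> is chosen so large
  that \<open>x + t *\<^sub>R ?e\<close> has norm above \<open>R\<close>.\<close>

lemma smooth_supported_partial_deriv_0_imp_0:
  fixes f :: "real^'n \<Rightarrow> real"
  assumes f: "smooth_supported K f" and zero: "\<And>x. partial_deriv i f x = 0"
  shows "f x = 0"
proof -
  let ?e = "axis i 1 :: real^'n"
  have smooth: "smooth_on UNIV f" and K: "compact K" "\<And>x. x \<notin> K \<Longrightarrow> f x = 0"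
    using f by (auto simp: smooth_supported_def)
  obtain R where R: "\<And>x. x \<in> K \<Longrightarrow> norm x \<le> R"
    using compact_imp_bounded[OF K(1)] unfolding bounded_iff by blast
  define t where "t = \<bar>R\<bar> + norm x + 1"
  have "norm (t *\<^sub>R ?e) \<le> norm (x + t *\<^sub>R ?e) + norm x"
    by (metis add_diff_cancel_left' norm_triangle_ineq4)
  then have "x + t *\<^sub>R ?e \<notin> K"
    using R[of "x + t *\<^sub>R ?e"] by (auto simp: t_def norm_axis_1)
  moreover have "f (x + t *\<^sub>R ?e) = f (x + 0 *\<^sub>R ?e)"
    using DERIV_isconst_all[of "\<lambda>t. f (x + t *\<^sub>R ?e)"] partial_deriv_along_line[OF smooth] zero
    by metis
  ultimately show ?thesis
    using K(2) by simp
qed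

text \<open>Used in contrapositive form: the \<open>k\<close>-th derivative of a nonzero bump in one
  direction is not identically zero, so the profile \<open>\<phi>\<close> of the counterexample is
  nontrivial.\<close>

lemma iter_partial_replicate_0_imp_0:
  assumes "smooth_supported K f" "\<And>x. iter_partial (replicate l i) f x = 0"
  shows "f x = 0"
  using assms(2)
proof (induction l arbitrary: x)
  case (Suc l)
  have "iter_partial (replicate l i) f x = 0" for x
    using smooth_supported_partial_deriv_0_imp_0[OF smooth_supported_iter_partial[OF assms(1)],
        of i "replicate l i"] Suc.prems by simp
  then show ?case
    by (rule Suc.IH)
qed simp

section \<open>Weighted norms and their bounds from above and below\<close>

lemma weighted_Lp_norm_leI:
  assumes J: "(\<integral>\<^sup>+x\<in>\<Omega>. ennreal (\<bar>f x\<bar> powr p * d x powr \<alpha>) \<partial>lebesgue) \<le> ennreal B"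
    and "p > 0" "B \<ge> 0"
  shows "weighted_Lp_norm \<Omega> d \<alpha> p f \<le> ennreal (B powr (1 / p))"
proof -
  let ?J = "\<integral>\<^sup>+x\<in>\<Omega>. ennreal (\<bar>f x\<bar> powr p * d x powr \<alpha>) \<partial>lebesgue"
  have "?J \<noteq> \<infinity>"
    using J by (auto simp: top_unique)
  moreover have "enn2real ?J \<le> B"
    using J \<open>B \<ge> 0\<close> by (simp add: enn2real_leI)
  ultimately show ?thesis
    using \<open>p > 0\<close> unfolding weighted_Lp_norm_def Let_def
    by (auto intro!: ennreal_leI powr_mono2)
qed

lemma weighted_Lp_norm_geI:
  assumes J: "ennreal B \<le> (\<integral>\<^sup>+x\<in>\<Omega>. ennreal (\<bar>f x\<bar> powr p * d x powr \<alpha>) \<partial>lebesgue)"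
    and "p > 0" "B \<ge> 0"
  shows "ennreal (B powr (1 / p)) \<le> weighted_Lp_norm \<Omega> d \<alpha> p f"
proof (cases "(\<integral>\<^sup>+x\<in>\<Omega>. ennreal (\<bar>f x\<bar> powr p * d x powr \<alpha>) \<partial>lebesgue) = \<infinity>")
  case False
  then obtain j where j: "(\<integral>\<^sup>+x\<in>\<Omega>. ennreal (\<bar>f x\<bar> powr p * d x powr \<alpha>) \<partial>lebesgue) = ennreal j" "j \<ge> 0"
    by (cases "\<integral>\<^sup>+x\<in>\<Omega>. ennreal (\<bar>f x\<bar> powr p * d x powr \<alpha>) \<partial>lebesgue") auto
  then have "B \<le> j"
    using J by simp
  then show ?thesis
    unfolding weighted_Lp_norm_def j
    using assms(2,3) j(2) powr_mono2[of "1 / p" B j] by (simp add: ennreal_leI)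
qed (simp add: weighted_Lp_norm_def)

lemma nn_integral_const_cball:
  fixes c :: "'a::euclidean_space"
  assumes "\<epsilon> > 0" "B \<ge> 0"
  shows "(\<integral>\<^sup>+x. ennreal B * indicator (cball c \<epsilon>) x \<partial>lebesgue)
    = ennreal (B * (unit_ball_vol DIM('a) * \<epsilon> ^ DIM('a)))"
  using assms by (simp add: nn_integral_cmult_indicator emeasure_cball ennreal_mult)

text \<open>The Euclidean length of a vector is at most the sum of its absolute entries, here at
  most the number of index tuples times \<open>M\<close>. Everything is supported in the ball, where
  the weight is at most \<open>w\<close>, so each integral is bounded by a constant times the volume
  of the ball.\<close>

lemma sobolev_norm_smooth_le:
  fixes u :: "real^'n \<Rightarrow> real" and M w :: real
  assumes \<Omega>: "open \<Omega>" and u: "smooth_supported (cball c \<epsilon>) u"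
    and bd: "\<And>js x. length js \<le> m \<Longrightarrow> \<bar>iter_partial js u x\<bar> \<le> M"
    and wt: "\<And>x. x \<in> cball c \<epsilon> \<Longrightarrow> d x powr \<alpha> \<le> w"
    and "p \<ge> 1" "M \<ge> 0" "w \<ge> 0" "\<epsilon> > 0"
  shows "sobolev_norm \<Omega> d \<alpha> m p u \<le>
    ennreal (\<Sum>j\<le>m. ((card {js :: 'n list. length js = j} * M) powr p * w
      * (unit_ball_vol (real CARD('n)) * \<epsilon> ^ CARD('n))) powr (1 / p))"
proof -
  have smooth: "smooth_on UNIV u"
    using u by (simp add: smooth_supported_def)
  have "weighted_Lp_norm \<Omega> d \<alpha> p (grad_norm \<Omega> j u) \<le>
      ennreal (((card {js :: 'n list. length js = j} * M) powr p * w
        * (unit_ball_vol (real CARD('n)) * \<epsilon> ^ CARD('n))) powr (1 / p))" if "j \<le> m" for j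
  proof (rule weighted_Lp_norm_leI)
    let ?S = "{js :: 'n list. length js = j}"
    have fin: "finite ?S"
      using finite_lists_length_eq[of "UNIV :: 'n set" j] by simp
    have "AE x in lebesgue. \<forall>js\<in>?S. x \<in> \<Omega> \<longrightarrow> weak_deriv \<Omega> js u x = iter_partial (rev js) u x"
      using weak_deriv_smooth[OF \<Omega> smooth] by (intro AE_finite_allI[OF fin])
    then have "AE x in lebesgue. x \<in> \<Omega> \<longrightarrow> \<bar>grad_norm \<Omega> j u x\<bar> \<le> card ?S * M * indicator (cball c \<epsilon>) x"
    proof eventually_elim
      case (elim x)
      show ?case
      proof
        assume "x \<in> \<Omega>"
        have "\<bar>iter_partial (rev js) u x\<bar> \<le> M * indicator (cball c \<epsilon>) x" if "js \<in> ?S" for js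
          using bd[of "rev js" x] smooth_supported_iter_partial[OF u, of "rev js"] that \<open>j \<le> m\<close>
          by (auto simp: smooth_supported_def indicator_def)
        then have "(\<Sum>js\<in>?S. \<bar>weak_deriv \<Omega> js u x\<bar>) \<le> card ?S * (M * indicator (cball c \<epsilon>) x)"
          using elim \<open>x \<in> \<Omega>\<close> by (intro sum_bounded_above) auto
        then show "\<bar>grad_norm \<Omega> j u x\<bar> \<le> card ?S * M * indicator (cball c \<epsilon>) x"
          using L2_set_le_sum_abs[of "\<lambda>js. weak_deriv \<Omega> js u x" ?S] by (simp add: grad_norm_def L2_set_nonneg)
      qed
    qed
    then have "(\<integral>\<^sup>+x\<in>\<Omega>. ennreal (\<bar>grad_norm \<Omega> j u x\<bar> powr p * d x powr \<alpha>) \<partial>lebesgue)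
        \<le> (\<integral>\<^sup>+x. ennreal ((card ?S * M) powr p * w) * indicator (cball c \<epsilon>) x \<partial>lebesgue)"
    proof (intro nn_integral_mono_AE, eventually_elim)
      case (elim x)
      show ?case
      proof (cases "x \<in> \<Omega> \<and> x \<in> cball c \<epsilon>")
        case True
        then have "\<bar>grad_norm \<Omega> j u x\<bar> powr p * d x powr \<alpha> \<le> (card ?S * M) powr p * w"
          using elim wt \<open>p \<ge> 1\<close> by (intro mult_mono powr_mono2) auto
        then show ?thesis
          using True by (simp add: ennreal_leI)
      next
        case False
        then show ?thesis
          using elim by (auto simp: indicator_def)
      qed
    qed
    also have "\<dots> = ennreal ((card ?S * M) powr p * w * (unit_ball_vol (real CARD('n)) * \<epsilon> ^ CARD('n)))"
      using nn_integral_const_cball[of \<epsilon> "(card ?S * M) powr p * w" c] assms by simp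
    finally show "(\<integral>\<^sup>+x\<in>\<Omega>. ennreal (\<bar>grad_norm \<Omega> j u x\<bar> powr p * d x powr \<alpha>) \<partial>lebesgue) \<le> \<dots>" .
  qed (use assms in auto)
  then have "(\<Sum>j\<le>m. weighted_Lp_norm \<Omega> d \<alpha> p (grad_norm \<Omega> j u)) \<le>
      (\<Sum>j\<le>m. ennreal (((card {js :: 'n list. length js = j} * M) powr p * w
        * (unit_ball_vol (real CARD('n)) * \<epsilon> ^ CARD('n))) powr (1 / p)))"
    by (intro sum_mono) auto
  moreover have "weakly_differentiable \<Omega> m u"
    unfolding weakly_differentiable_def using has_weak_deriv_smooth[OF smooth] by blast
  ultimately show ?thesis
    by (simp add: sobolev_norm_def sum_ennreal)
qed

text \<open>\<open>u\<close> is approximated by itself, with the zero function as error. That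
  function's norm is a hypothesis because it too is built from chosen weak derivatives.\<close>

lemma test_function_in_sobolev_space_0:
  assumes "open \<Omega>" "p \<ge> 1" "u \<in> test_functions \<Omega>" "sobolev_norm \<Omega> d \<alpha> m p u < \<infinity>"
    and "sobolev_norm \<Omega> d \<alpha> m p (\<lambda>x. 0) = 0"
  shows "u \<in> sobolev_space_0 \<Omega> d \<alpha> m p"
  using assms by (auto simp: sobolev_space_0_def sobolev_space_def sobolev_norm_def split: if_splits intro!: bexI[of _ u])

text \<open>Either \<open>t \<le> s\<close>, or \<open>t / s > 1\<close> and multiplying
  \<open>t\<close> by \<open>(t / s) powr (q - 1) \<ge> 1\<close> produces the second term. The
  threshold \<open>s\<close> stays free.\<close>

lemma le_add_powr:
  fixes s t q :: real
  assumes "s > 0" "t \<ge> 0" "q \<ge> 1"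
  shows "t \<le> s + s powr (1 - q) * t powr q"
proof (cases "t \<le> s")
  case False
  then have "1 \<le> (t / s) powr (q - 1)"
    using assms by (intro ge_one_powr_ge_zero) auto
  then have "t \<le> t * (t / s) powr (q - 1)"
    using assms by (simp add: mult_le_cancel_left1)
  also have "\<dots> = s powr (1 - q) * t powr q"
  proof -
    have "(t / s) powr (q - 1) = t powr (q - 1) * s powr (1 - q)"
      using assms powr_minus[of s "q - 1"] powr_divide[of t s "q - 1"] by (simp add: divide_inverse)
    moreover have "t powr q = t * t powr (q - 1)"
      using powr_mult_base[OF assms(2), of "q - 1"] by simp
    ultimately show ?thesis
      by simp
  qed
  finally show ?thesis
    using assms by linarith
qed (use assms in \<open>simp add: add_increasing2\<close>)

text \<open>In place of Hoelder's inequality, \<open>t \<le> s + s powr (1 - q) * t powr q\<close> is integrated, with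
  \<open>s\<close> such that the first term amounts to half of the lower bound.\<close>

lemma weighted_integral_weak_deriv_ge:
  fixes \<psi> :: "real^'n \<Rightarrow> real"
  assumes w: "has_weak_deriv \<Omega> js v w" and \<psi>: "smooth_supported (cball c \<epsilon>) \<psi>"
    and sub: "cball c \<epsilon> \<subseteq> \<Omega>" and bd: "\<And>x. \<bar>\<psi> x\<bar> \<le> M"
    and wt: "\<And>x. x \<in> cball c \<epsilon> \<Longrightarrow> w0 \<le> d x powr r"
    and L: "L \<le> (LINT x:\<Omega>|lebesgue. v x * iter_partial js \<psi> x)"
    and "q \<ge> 1" "\<epsilon> > 0" "w0 > 0" "M > 0" "L > 0"
  defines "V \<equiv> unit_ball_vol (real CARD('n)) * \<epsilon> ^ CARD('n)"
  shows "ennreal (w0 * V * (L / (2 * M * V)) powr q)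
    \<le> (\<integral>\<^sup>+x\<in>\<Omega>. ennreal (\<bar>w x\<bar> powr q * d x powr r) \<partial>lebesgue)"
    (is "_ \<le> ?J")
proof (cases "?J = \<infinity>")
  case False
  then obtain j where j: "?J = ennreal j" "j \<ge> 0"
    by (cases ?J) auto
  have V: "V > 0"
    using \<open>\<epsilon> > 0\<close> by (simp add: V_def)
  define s where "s = L / (2 * M * V)"
  have s: "s > 0"
    using V \<open>L > 0\<close> \<open>M > 0\<close> by (simp add: s_def)
  let ?B = "cball c \<epsilon>"
  let ?w = "\<lambda>x. indicator ?B x *\<^sub>R w x"
  have test: "\<psi> \<in> test_functions \<Omega>"
    using \<psi> sub test_functions_iff by blast
  have int: "integrable lebesgue ?w"
    using w sub unfolding has_weak_deriv_def locally_integrable_def set_integrable_def by simp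
  then have [measurable]: "?w \<in> borel_measurable lebesgue"
    by simp
  \<comment> \<open>The absolute value absorbs the sign \<open>(- 1) ^ length js\<close> in the
    definition of a weak derivative.\<close>
  have "L \<le> \<bar>LINT x:\<Omega>|lebesgue. v x * iter_partial js \<psi> x\<bar>"
    using L by linarith
  also have "\<dots> = \<bar>LINT x:\<Omega>|lebesgue. w x * \<psi> x\<bar>"
    using w test unfolding has_weak_deriv_def by (simp add: abs_mult power_abs)
  also have "\<dots> = \<bar>LINT x|lebesgue. ?w x * \<psi> x\<bar>"
    unfolding set_lebesgue_integral_def
    using \<psi> sub by (intro arg_cong[where f = abs] Bochner_Integration.integral_cong)
      (auto simp: indicator_def smooth_supported_def)
  also have "\<dots> \<le> (LINT x|lebesgue. M * \<bar>?w x\<bar>)"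
  proof (rule order.trans[OF integral_abs_bound integral_mono'])
    show "integrable lebesgue (\<lambda>x. M * \<bar>?w x\<bar>)"
      using int by (intro integrable_mult_right integrable_abs)
    show "\<bar>?w x * \<psi> x\<bar> \<le> M * \<bar>?w x\<bar>" for x
      by (metis abs_ge_zero abs_mult bd mult.commute mult_left_mono)
    show "0 \<le> M * \<bar>?w x\<bar>" for x
      using \<open>M > 0\<close> by simp
  qed
  also have "\<dots> = M * (LINT x|lebesgue. \<bar>?w x\<bar>)"
    by simp
  finally have LM: "L / M \<le> (LINT x|lebesgue. \<bar>?w x\<bar>)"
    using \<open>M > 0\<close> by (simp add: field_simps)
  have "ennreal (LINT x|lebesgue. \<bar>?w x\<bar>) = (\<integral>\<^sup>+x. ennreal \<bar>?w x\<bar> \<partial>lebesgue)"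
    using int by (intro nn_integral_eq_integral[symmetric]) auto
  also have "\<dots> \<le> (\<integral>\<^sup>+x. ennreal s * indicator ?B x
      + ennreal (s powr (1 - q)) * ennreal (\<bar>?w x\<bar> powr q) \<partial>lebesgue)"
  proof (rule nn_integral_mono)
    fix x
    show "ennreal \<bar>?w x\<bar> \<le> ennreal s * indicator ?B x + ennreal (s powr (1 - q)) * ennreal (\<bar>?w x\<bar> powr q)"
    proof (cases "x \<in> ?B")
      case True
      have "ennreal \<bar>w x\<bar> \<le> ennreal (s + s powr (1 - q) * \<bar>w x\<bar> powr q)"
        using le_add_powr[of s "\<bar>w x\<bar>" q] s \<open>q \<ge> 1\<close> by (intro ennreal_leI) simp
      also have "\<dots> = ennreal s + ennreal (s powr (1 - q)) * ennreal (\<bar>w x\<bar> powr q)"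
        using s by (simp add: ennreal_mult ennreal_plus)
      finally show ?thesis
        using True by simp
    qed simp
  qed
  also have "\<dots> = ennreal (s * V) + ennreal (s powr (1 - q)) * (\<integral>\<^sup>+x. ennreal (\<bar>?w x\<bar> powr q) \<partial>lebesgue)"
  proof -
    have "(\<lambda>x. ennreal (\<bar>?w x\<bar> powr q)) \<in> borel_measurable lebesgue"
      by measurable
    moreover have "(\<lambda>x. ennreal s * indicator ?B x) \<in> borel_measurable lebesgue"
      by (intro borel_measurable_times_ennreal borel_measurable_const borel_measurable_indicator) simp
    ultimately show ?thesis
      using nn_integral_const_cball[of \<epsilon> s c] s \<open>\<epsilon> > 0\<close>
      by (subst nn_integral_add) (simp_all add: V_def nn_integral_cmult)
  qed
  \<comment> \<open>The lower bound \<open>w0\<close> of the weight on the ball turns the unweighted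
    integral into the weighted one.\<close>
  also have "(\<integral>\<^sup>+x. ennreal (\<bar>?w x\<bar> powr q) \<partial>lebesgue) \<le> ennreal (j / w0)"
  proof -
    have "ennreal w0 * (\<integral>\<^sup>+x. ennreal (\<bar>?w x\<bar> powr q) \<partial>lebesgue)
        = (\<integral>\<^sup>+x. ennreal w0 * ennreal (\<bar>?w x\<bar> powr q) \<partial>lebesgue)"
      by (rule nn_integral_cmult[symmetric]) measurable
    also have "\<dots> \<le> ?J"
    proof (rule nn_integral_mono)
      fix x
      show "ennreal w0 * ennreal (\<bar>?w x\<bar> powr q) \<le> ennreal (\<bar>w x\<bar> powr q * d x powr r) * indicator \<Omega> x"
      proof (cases "x \<in> ?B")
        case True
        then have "x \<in> \<Omega>"
          using sub by blast
        then show ?thesis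
          using True wt[of x] \<open>w0 > 0\<close>
          by (simp add: ennreal_mult[symmetric] mult.commute ennreal_leI mult_right_mono)
      qed simp
    qed
    finally have "ennreal w0 * (\<integral>\<^sup>+x. ennreal (\<bar>?w x\<bar> powr q) \<partial>lebesgue) \<le> ennreal j"
      using j by simp
    then show ?thesis
      using \<open>w0 > 0\<close> j(2)
      by (cases "\<integral>\<^sup>+x. ennreal (\<bar>?w x\<bar> powr q) \<partial>lebesgue")
        (auto simp: ennreal_mult[symmetric] field_simps ennreal_mult_top top_unique)
  qed
  finally have "ennreal (LINT x|lebesgue. \<bar>?w x\<bar>) \<le> ennreal (s * V) + ennreal (s powr (1 - q)) * ennreal (j / w0)"
    by (simp add: mult_left_mono add_left_mono)
  also have "\<dots> = ennreal (s * V + s powr (1 - q) * (j / w0))"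
    using s V j \<open>w0 > 0\<close> by (simp add: ennreal_mult ennreal_plus del: times_divide_eq_right)
  finally have "(LINT x|lebesgue. \<bar>?w x\<bar>) \<le> s * V + s powr (1 - q) * (j / w0)"
    using s V j \<open>w0 > 0\<close> by (subst (asm) ennreal_le_iff) auto
  with LM have "L / M \<le> s * V + s powr (1 - q) * (j / w0)"
    by linarith
  \<comment> \<open>By the choice of \<open>s\<close>, the term \<open>s * V\<close> is half of the
    left-hand side, so the other half must come from the integral. Multiplying by
    \<open>s powr (q - 1)\<close> then isolates \<open>j\<close>.\<close>
  moreover have "L / M = 2 * (s * V)"
    using V \<open>M > 0\<close> by (simp add: s_def)
  ultimately have "s * V \<le> s powr (1 - q) * (j / w0)"
    by linarith
  then have "s powr (q - 1) * (s * V) \<le> s powr (q - 1) * (s powr (1 - q) * (j / w0))"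
    by (rule mult_left_mono) simp
  also have "\<dots> = j / w0"
    using s by (simp add: powr_add[symmetric] mult.assoc[symmetric])
  finally have "w0 * V * s powr q \<le> j"
    using s \<open>w0 > 0\<close> by (simp add: powr_diff field_simps)
  then show ?thesis
    unfolding j(1) s_def by (rule ennreal_leI)
qed simp

text \<open>Extracts the power of \<open>\<epsilon>\<close> from both estimates: with
  \<open>p\<close> and \<open>l = m\<close> from the upper bound of the norm of \<open>u\<close>,
  with \<open>q\<close> and \<open>l = k\<close> from the lower bound of the norm of the
  quotient.\<close>

lemma weighted_norm_scaling:
  fixes c w V \<epsilon> :: real
  assumes "c \<ge> 0" "w \<ge> 0" "V \<ge> 0" "\<epsilon> > 0" "p \<ge> 1"
  shows "((c * (1 / \<epsilon>) ^ l) powr p * w * (V * \<epsilon> ^ n)) powr (1 / p)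
    = c * (w * V) powr (1 / p) * \<epsilon> powr (real n / p - real l)"
proof -
  have "(1 / \<epsilon>) ^ l = \<epsilon> powr (- real l)" "\<epsilon> ^ n = \<epsilon> powr real n"
    using assms by (simp_all add: powr_minus powr_realpow field_simps)
  then have "(c * (1 / \<epsilon>) ^ l) powr p * w * (V * \<epsilon> ^ n)
      = (c powr p * \<epsilon> powr (- real l * p)) * w * (V * \<epsilon> powr real n)"
    using assms by (simp add: powr_mult powr_powr)
  also have "\<dots> = c powr p * (w * V) * \<epsilon> powr (real n - real l * p)"
    using powr_add[of \<epsilon> "- real l * p" "real n"] by (simp add: algebra_simps)
  also have "\<dots> powr (1 / p) = (c powr p) powr (1 / p) * (w * V) powr (1 / p)
      * (\<epsilon> powr (real n - real l * p)) powr (1 / p)"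
    using assms by (simp add: powr_mult)
  also have "(c powr p) powr (1 / p) = c"
    using assms by (simp add: powr_powr)
  also have "(\<epsilon> powr (real n - real l * p)) powr (1 / p) = \<epsilon> powr (real n / p - real l)"
    using assms by (simp add: powr_powr diff_divide_distrib)
  finally show ?thesis .
qed

section \<open>Rescaled bumps and integrals of their squares\<close>

lemma smooth_supported_scale:
  assumes "smooth_supported (cball 0 1) f" "\<epsilon> > 0"
  shows "smooth_supported (cball c \<epsilon>) (\<lambda>x. f ((1 / \<epsilon>) *\<^sub>R (x - c)))"
  unfolding smooth_supported_def
proof (intro conjI allI impI)
  show "smooth_on UNIV (\<lambda>x. f ((1 / \<epsilon>) *\<^sub>R (x - c)))"
    using assms by (intro smooth_on_scale) (simp add: smooth_supported_def)
  fix x assume "x \<notin> cball c \<epsilon>"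
  then have "(1 / \<epsilon>) *\<^sub>R (x - c) \<notin> cball 0 1"
    using assms(2) by (simp add: dist_norm norm_minus_commute pos_divide_le_eq)
  then show "f ((1 / \<epsilon>) *\<^sub>R (x - c)) = 0"
    using assms(1) unfolding smooth_supported_def by blast
qed simp

lemma smooth_supported_unit_ball_exists:
  obtains \<psi> :: "real^'n \<Rightarrow> real" and x where "smooth_supported (cball 0 1) \<psi>" "\<psi> x \<noteq> 0"
proof -
  obtain a b :: "real^'n" where ab: "0 \<in> box a b" "box a b \<subseteq> ball 0 1"
    using rational_boxes[of 1 "0 :: real^'n"] by auto
  obtain \<psi> where "smooth_on UNIV \<psi>" and nn: "\<And>x. \<psi> x \<ge> 0" and pos: "\<And>x. \<psi> x > 0 \<longleftrightarrow> x \<in> box a b"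
    by (rule box_bump_exists[of a b]) blast
  moreover have "\<psi> x = 0" if "x \<notin> cball 0 1" for x
    using that ab(2) nn[of x] pos[of x] ball_subset_cball by (auto simp: order_less_le)
  ultimately have "smooth_supported (cball 0 1) \<psi>"
    by (auto simp: smooth_supported_def)
  moreover have "\<psi> 0 \<noteq> 0"
    using pos[of 0] ab(1) by simp
  ultimately show ?thesis
    using that by blast
qed

lemma derivatives_bounded:
  fixes f :: "real^'n \<Rightarrow> real"
  assumes "smooth_supported K f"
  obtains M where "M > 0" "\<And>js x. length js \<le> m \<Longrightarrow> \<bar>iter_partial js f x\<bar> \<le> M"
proof -
  have "\<exists>M>0. \<forall>x. \<bar>iter_partial js f x\<bar> \<le> M" for js
    using smooth_supported_bounded[OF smooth_supported_iter_partial[OF assms]] by metis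
  then obtain M where M: "\<And>js. M js > 0" "\<And>js x. \<bar>iter_partial js f x\<bar> \<le> M js"
    by metis
  let ?S = "{js :: 'n list. length js \<le> m}"
  have fin: "finite ?S"
    using finite_lists_length_le[of "UNIV :: 'n set" m] by simp
  show ?thesis
  proof
    show "sum M ?S > 0"
      using fin M(1) by (intro sum_pos) (auto intro: exI[of _ "[]"])
    show "\<bar>iter_partial js f x\<bar> \<le> sum M ?S" if "length js \<le> m" for js x
    proof (rule order.trans[OF M(2)])
      show "M js \<le> sum M ?S"
        using fin that M(1) by (intro member_le_sum) (auto intro: less_imp_le)
    qed
  qed
qed

text \<open>Were the integral zero, \<open>f\<close> would vanish almost everywhere; but by
  continuity its nonvanishing set is open, and a nonempty open set is not null.\<close>

lemma integral_square_pos: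
  fixes f :: "real^'n \<Rightarrow> real"
  assumes f: "smooth_supported K f" and "f x \<noteq> 0"
  shows "(\<integral>x. (f x)\<^sup>2 \<partial>lborel) > 0"
proof -
  have smooth: "smooth_on UNIV f"
    using f by (simp add: smooth_supported_def)
  have int: "integrable lborel (\<lambda>x. (f x)\<^sup>2)"
    using smooth_supported_integrable[OF smooth_supported_mult[OF smooth f]]
    by (simp add: power2_eq_square)
  have "(\<integral>x. (f x)\<^sup>2 \<partial>lborel) \<noteq> 0"
  proof
    assume "(\<integral>x. (f x)\<^sup>2 \<partial>lborel) = 0"
    then have "AE x in lborel. f x = 0"
      using int by (subst (asm) integral_nonneg_eq_0_iff_AE) auto
    moreover have "open {x. f x \<noteq> 0}"
      using smooth_on_continuous_on[OF smooth] by (intro open_Collect_neq continuous_on_const)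
    ultimately have "{x. f x \<noteq> 0} \<in> null_sets lborel"
      using AE_iff_null[of lborel "\<lambda>x. f x = 0"] by simp
    then have "negligible {x. f x \<noteq> 0}"
      by (simp add: negligible_iff_null_sets null_sets_completionI)
    with \<open>open _\<close> show False
      using open_not_negligible \<open>f x \<noteq> 0\<close> by blast
  qed
  moreover have "(\<integral>x. (f x)\<^sup>2 \<partial>lborel) \<ge> 0"
    by (rule integral_nonneg_AE) simp
  ultimately show ?thesis
    by linarith
qed

lemma integral_square_le:
  assumes u: "smooth_supported K u" and h: "continuous_on K h" and "K \<subseteq> \<Omega>"
    and bd: "\<And>x. x \<in> K \<Longrightarrow> b \<le> h x"
  shows "b * (\<integral>x. (u x)\<^sup>2 \<partial>lborel) \<le> (LINT x:\<Omega>|lebesgue. h x * (u x)\<^sup>2)"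
proof -
  have smooth: "smooth_on UNIV u" and K: "compact K" "\<And>x. x \<notin> K \<Longrightarrow> u x = 0"
    using u by (auto simp: smooth_supported_def)
  let ?g = "\<lambda>x. indicator K x *\<^sub>R (h x * (u x)\<^sup>2)"
  have g: "integrable lborel ?g"
    using smooth_on_continuous_on[OF smooth] continuous_on_subset h
    by (intro borel_integrable_compact K(1) continuous_intros) auto
  have "b * (\<integral>x. (u x)\<^sup>2 \<partial>lborel) = (\<integral>x. b * (u x)\<^sup>2 \<partial>lborel)"
    by simp
  also have "\<dots> \<le> integral\<^sup>L lborel ?g"
  proof (rule integral_mono[OF _ g])
    show "integrable lborel (\<lambda>x. b * (u x)\<^sup>2)"
      using smooth_supported_integrable[OF smooth_supported_mult[OF smooth u]]
      by (simp add: power2_eq_square)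
    show "b * (u x)\<^sup>2 \<le> ?g x" for x
      using bd[of x] K(2)[of x] by (cases "x \<in> K") (auto intro: mult_right_mono)
  qed
  also have "\<dots> = integral\<^sup>L lebesgue ?g"
    using g by (intro integral_completion[symmetric]) auto
  also have "\<dots> = (LINT x:\<Omega>|lebesgue. h x * (u x)\<^sup>2)"
    unfolding set_lebesgue_integral_def
    using K(2) \<open>K \<subseteq> \<Omega>\<close> by (intro Bochner_Integration.integral_cong) (auto simp: indicator_def)
  finally show ?thesis .
qed

lemma continuous_pos_bounds:
  fixes g :: "'a::topological_space \<Rightarrow> real"
  assumes "compact K" "K \<noteq> {}" "continuous_on K g" "\<And>x. x \<in> K \<Longrightarrow> g x > 0"
  obtains a b where "a > 0" "b > 0" "\<And>x. x \<in> K \<Longrightarrow> a \<le> g x" "\<And>x. x \<in> K \<Longrightarrow> g x \<le> b"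
  using continuous_attains_inf[OF assms(1-3)] continuous_attains_sup[OF assms(1-3)] assms(4)
  by metis

text \<open>A single entry of the gradient of order \<open>k\<close> bounds its length from below.
  The hypothesis covers all weak derivatives since \<open>weak_deriv\<close> may pick any of them,
  and without weak differentiability the norm is infinite.\<close>

lemma sobolev_norm_ge_weak_deriv:
  fixes v :: "real^'n \<Rightarrow> real"
  assumes js: "length js = k" "js \<noteq> []" and "q \<ge> 1" "B \<ge> 0"
    and ge: "\<And>w. has_weak_deriv \<Omega> js v w \<Longrightarrow>
      ennreal B \<le> (\<integral>\<^sup>+x\<in>\<Omega>. ennreal (\<bar>w x\<bar> powr q * d x powr r) \<partial>lebesgue)"
  shows "ennreal (B powr (1 / q)) \<le> sobolev_norm \<Omega> d r k q v"
proof (cases "weakly_differentiable \<Omega> k v")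
  case True
  let ?w = "weak_deriv \<Omega> js v"
  let ?S = "{js :: 'n list. length js = k}"
  have fin: "finite ?S"
    using finite_lists_length_eq[of "UNIV :: 'n set" k] by simp
  have "has_weak_deriv \<Omega> js v ?w"
    using True js someI_ex[of "has_weak_deriv \<Omega> js v"]
    unfolding weakly_differentiable_def weak_deriv_def by auto
  then have "ennreal B \<le> (\<integral>\<^sup>+x\<in>\<Omega>. ennreal (\<bar>?w x\<bar> powr q * d x powr r) \<partial>lebesgue)"
    by (rule ge)
  also have "\<dots> \<le> (\<integral>\<^sup>+x\<in>\<Omega>. ennreal (\<bar>grad_norm \<Omega> k v x\<bar> powr q * d x powr r) \<partial>lebesgue)"
  proof (intro nn_integral_mono mult_right_mono ennreal_leI powr_mono2)
    fix x
    have "\<bar>?w x\<bar> \<le> L2_set (\<lambda>js. \<bar>weak_deriv \<Omega> js v x\<bar>) ?S"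
      using js by (intro member_le_L2_set[OF fin]) auto
    then show "\<bar>?w x\<bar> \<le> \<bar>grad_norm \<Omega> k v x\<bar>"
      by (simp add: grad_norm_def L2_set_nonneg L2_set_def)
  qed (use \<open>q \<ge> 1\<close> in auto)
  finally have "ennreal (B powr (1 / q)) \<le> weighted_Lp_norm \<Omega> d r q (grad_norm \<Omega> k v)"
    using assms by (intro weighted_Lp_norm_geI) auto
  also have "\<dots> \<le> (\<Sum>j\<le>k. weighted_Lp_norm \<Omega> d r q (grad_norm \<Omega> j v))"
    by (rule member_le_sum) auto
  finally show ?thesis
    using True by (simp add: sobolev_norm_def)
qed (simp add: sobolev_norm_def)

theorem proposition3p2:
  fixes \<Omega> :: "(real^'n) set" and d :: "real^'n \<Rightarrow> real"
    and k m :: nat and p q r :: real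
  assumes "CARD('n) \<ge> 2" and "m \<ge> 2" and "1 \<le> k" and "k \<le> m - 1"
    and "1 \<le> p" and "p \<le> q"
    and "1 / q < (real CARD('n) - p * (real m - real k)) / (real CARD('n) * p)"
    and "\<Omega> \<noteq> {}" and "bounded \<Omega>" and "open \<Omega>" and "smooth_boundary \<Omega>"
    and "smoothed_distance \<Omega> d"
  shows "\<not> (\<exists>C::real. \<forall>u \<in> sobolev_space_0 \<Omega> d (p - 1) m p.
           sobolev_norm \<Omega> d r k q (\<lambda>x. u x / d x ^ (m - k))
             \<le> ennreal C * sobolev_norm \<Omega> d (p - 1) m p u)"
proof
  assume "\<exists>C::real. \<forall>u \<in> sobolev_space_0 \<Omega> d (p - 1) m p.
           sobolev_norm \<Omega> d r k q (\<lambda>x. u x / d x ^ (m - k))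
             \<le> ennreal C * sobolev_norm \<Omega> d (p - 1) m p u"
  then obtain C where C: "\<And>u. u \<in> sobolev_space_0 \<Omega> d (p - 1) m p \<Longrightarrow>
      sobolev_norm \<Omega> d r k q (\<lambda>x. u x / d x ^ (m - k)) \<le> ennreal C * sobolev_norm \<Omega> d (p - 1) m p u"
    by blast
  let ?n = "CARD('n)"
  let ?V = "unit_ball_vol (real ?n)"
  have d_pos: "\<And>x. x \<in> \<Omega> \<Longrightarrow> d x > 0" and d_cont: "continuous_on \<Omega> d"
    using assms(12) smooth_on_continuous_on by (auto simp: smoothed_distance_def)
  obtain c where c: "c \<in> \<Omega>"
    using assms(8) by blast
  obtain R0 where R0: "R0 > 0" "cball c R0 \<subseteq> \<Omega>"
    using c \<open>open \<Omega>\<close> open_contains_cball by blast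
  \<comment> \<open>The cap 1 ensures \<open>1 / \<epsilon> \<ge> 1\<close> for all scales
    considered, so the power of order \<open>m\<close> dominates the lower ones.\<close>
  define R where "R = min R0 1"
  have R: "0 < R" "R \<le> 1" "cball c R \<subseteq> \<Omega>"
    using R0 by (auto simp: R_def)
  have ball: "compact (cball c R)" "cball c R \<noteq> {}"
    using R by auto
  have d': "continuous_on (cball c R) d" "\<And>x. x \<in> cball c R \<Longrightarrow> d x > 0"
    using d_cont d_pos R(3) continuous_on_subset by blast+
  have "continuous_on (cball c R) (\<lambda>x. d x powr \<alpha>)" for \<alpha>
    using d' by (intro continuous_intros) force+
  then have weight: "\<exists>a>0. \<exists>b>0. \<forall>x\<in>cball c R. a \<le> d x powr \<alpha> \<and> d x powr \<alpha> \<le> b" for \<alpha>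
    using continuous_pos_bounds[OF ball, of "\<lambda>x. d x powr \<alpha>"] d'(2) by (metis powr_gt_zero less_irrefl)
  obtain w2 where w2: "w2 > 0" "\<And>x. x \<in> cball c R \<Longrightarrow> d x powr (p - 1) \<le> w2"
    using weight[of "p - 1"] by blast
  obtain w0 where w0: "w0 > 0" "\<And>x. x \<in> cball c R \<Longrightarrow> w0 \<le> d x powr r"
    using weight[of r] by blast
  have cont: "continuous_on (cball c R) (\<lambda>x. 1 / d x ^ (m - k))"
    using d' by (intro continuous_intros) force+
  obtain b where b: "b > 0" "\<And>x. x \<in> cball c R \<Longrightarrow> b \<le> 1 / d x ^ (m - k)"
    using continuous_pos_bounds[OF ball cont] d'(2) by (metis zero_less_divide_1_iff zero_less_power)
  obtain i :: 'n where True by blast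
  define js where "js = replicate k i"
  have js: "length js = k" "js \<noteq> []"
    using assms(3) by (auto simp: js_def)
  obtain \<psi> :: "real^'n \<Rightarrow> real" and y where \<psi>: "smooth_supported (cball 0 1) \<psi>" "\<psi> y \<noteq> 0"
    by (rule smooth_supported_unit_ball_exists)
  define \<phi> where "\<phi> = iter_partial js \<psi>"
  have \<phi>: "smooth_supported (cball 0 1) \<phi>"
    unfolding \<phi>_def by (rule smooth_supported_iter_partial[OF \<psi>(1)])
  obtain z where z: "\<phi> z \<noteq> 0"
    using iter_partial_replicate_0_imp_0[OF \<psi>(1)] \<psi>(2) unfolding \<phi>_def js_def by blast
  define I where "I = (\<integral>x. (\<phi> x)\<^sup>2 \<partial>lborel)"
  have I: "I > 0"
    unfolding I_def by (rule integral_square_pos[OF \<phi> z])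
  obtain M1 where M1: "M1 > 0" "\<And>js x. length js \<le> m \<Longrightarrow> \<bar>iter_partial js \<phi> x\<bar> \<le> M1"
    using derivatives_bounded[OF \<phi>] by metis
  obtain M2 where M2: "M2 > 0" "\<And>x. \<bar>\<psi> x\<bar> \<le> M2"
    using smooth_supported_bounded[OF \<psi>(1)] by metis
  have V: "?V > 0" and V0: "?V \<noteq> 0"
    using unit_ball_vol_pos[of "real ?n"] by linarith+
  \<comment> \<open>\<open>A\<close> and \<open>a\<close> are the factors independent of
    \<open>\<epsilon>\<close> that \<open>weighted_norm_scaling\<close> leaves in the upper and the
    lower bound.\<close>
  define A where "A = (\<Sum>j\<le>m. card {js :: 'n list. length js = j} * M1 * (w2 * ?V) powr (1 / p))"
  define a where "a = b * I / (2 * M2 * ?V) * (w0 * ?V) powr (1 / q)"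
  have "a > 0"
    using b(1) I M2(1) V w0(1) V0 unfolding a_def by (intro mult_pos_pos divide_pos_pos) auto

  \<comment> \<open>Comparison of both norms at a fixed scale\<close>
  have main: "a * \<epsilon> powr (real ?n / q - real k) \<le> \<bar>C\<bar> * A * \<epsilon> powr (real ?n / p - real m)"
    if \<epsilon>: "0 < \<epsilon>" "\<epsilon> \<le> R" for \<epsilon>
  proof -
    have sub: "cball c \<epsilon> \<subseteq> cball c R"
      using \<epsilon> by (intro subset_cball)
    then have sub': "cball c \<epsilon> \<subseteq> \<Omega>"
      using R by blast
    define u where "u x = \<phi> ((1 / \<epsilon>) *\<^sub>R (x - c))" for x
    define \<Psi> where "\<Psi> x = \<psi> ((1 / \<epsilon>) *\<^sub>R (x - c))" for x
    have u: "smooth_supported (cball c \<epsilon>) u" and \<Psi>: "smooth_supported (cball c \<epsilon>) \<Psi>"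
      unfolding u_def[abs_def] \<Psi>_def[abs_def]
      using \<phi> \<psi>(1) \<epsilon>(1) by (blast intro: smooth_supported_scale)+
    have D\<Psi>: "iter_partial js \<Psi> x = (1 / \<epsilon>) ^ k * u x" for x
      using iter_partial_scale[of \<psi> js "1 / \<epsilon>" c] \<psi>(1) js(1)
      unfolding u_def[abs_def] \<Psi>_def[abs_def] \<phi>_def by (simp add: smooth_supported_def)
    have Du: "\<bar>iter_partial js' u x\<bar> \<le> (1 / \<epsilon>) ^ m * M1" if "length js' \<le> m" for js' x
    proof -
      have "iter_partial js' u x = (1 / \<epsilon>) ^ length js' * iter_partial js' \<phi> ((1 / \<epsilon>) *\<^sub>R (x - c))"
        using iter_partial_scale[of \<phi> js' "1 / \<epsilon>" c] \<phi>
        unfolding u_def[abs_def] by (simp add: smooth_supported_def)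
      moreover have "(1 / \<epsilon>) ^ length js' \<le> (1 / \<epsilon>) ^ m"
        using \<epsilon> R that by (intro power_increasing) auto
      ultimately show ?thesis
        using \<epsilon> M1(2)[OF that] by (simp add: abs_mult mult_mono del: power_one_over)
    qed
    have "sobolev_norm \<Omega> d (p - 1) m p u \<le>
        ennreal (\<Sum>j\<le>m. ((card {js :: 'n list. length js = j} * ((1 / \<epsilon>) ^ m * M1)) powr p * w2
          * (?V * \<epsilon> ^ ?n)) powr (1 / p))"
      by (rule sobolev_norm_smooth_le[OF \<open>open \<Omega>\<close> u Du])
        (use \<epsilon> M1 w2 sub assms(5) in auto)
    also have "(\<Sum>j\<le>m. ((card {js :: 'n list. length js = j} * ((1 / \<epsilon>) ^ m * M1)) powr p * w2
          * (?V * \<epsilon> ^ ?n)) powr (1 / p)) = A * \<epsilon> powr (real ?n / p - real m)"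
      unfolding A_def sum_distrib_right
    proof (rule sum.cong)
      fix j
      show "((card {js :: 'n list. length js = j} * ((1 / \<epsilon>) ^ m * M1)) powr p * w2
          * (?V * \<epsilon> ^ ?n)) powr (1 / p)
        = card {js :: 'n list. length js = j} * M1 * (w2 * ?V) powr (1 / p) * \<epsilon> powr (real ?n / p - real m)"
        using weighted_norm_scaling[of "card {js :: 'n list. length js = j} * M1" w2 ?V \<epsilon> p m ?n]
          M1 w2 V \<epsilon> assms(5) by (simp add: mult_ac)
    qed simp
    finally have upper: "sobolev_norm \<Omega> d (p - 1) m p u \<le> ennreal (A * \<epsilon> powr (real ?n / p - real m))" .
    \<comment> \<open>The norm estimate with derivative bound 0 shows that the zero function has
      norm zero, as the membership of \<open>u\<close> in the closure demands.\<close>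
    have "sobolev_norm \<Omega> d (p - 1) m p (\<lambda>x. 0) \<le>
        ennreal (\<Sum>j\<le>m. ((real (card {js :: 'n list. length js = j}) * 0) powr p * w2
          * (?V * \<epsilon> ^ ?n)) powr (1 / p))"
    proof (rule sobolev_norm_smooth_le[OF \<open>open \<Omega>\<close>])
      show "smooth_supported (cball c \<epsilon>) (\<lambda>x. 0)"
        by (simp add: smooth_supported_def smooth_on_const)
      show "\<bar>iter_partial js (\<lambda>x. 0) x\<bar> \<le> 0" for js and x :: "real^'n"
        using iter_partial_zero_outside[of "{}" "\<lambda>x. 0" x js] by simp
    qed (use \<epsilon> w2 sub assms(5) in auto)
    then have zero: "sobolev_norm \<Omega> d (p - 1) m p (\<lambda>x. 0) = 0"
      by simp
    have mem: "u \<in> sobolev_space_0 \<Omega> d (p - 1) m p"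
    proof (rule test_function_in_sobolev_space_0[OF \<open>open \<Omega>\<close> assms(5) _ _ zero])
      show "u \<in> test_functions \<Omega>"
        using u sub' test_functions_iff by blast
      show "sobolev_norm \<Omega> d (p - 1) m p u < \<infinity>"
        using upper by (simp add: order.strict_trans1)
    qed
    let ?v = "\<lambda>x. u x / d x ^ (m - k)"
    \<comment> \<open>The first factor comes from \<open>D\<Psi>\<close>, the second bounds the
      reciprocal of \<open>d x ^ (m - k)\<close> from below, and the third is the integral of the
      square of \<open>u\<close>.\<close>
    define L where "L = (1 / \<epsilon>) ^ k * b * (\<epsilon> ^ ?n * I)"
    have "L > 0"
      using \<epsilon> b I by (simp add: L_def)
    have u2: "(\<integral>x. (u x)\<^sup>2 \<partial>lborel) = \<epsilon> ^ ?n * I"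
    proof -
      have "(\<lambda>x. (u x)\<^sup>2) \<in> borel_measurable borel"
        using u smooth_on_borel_measurable unfolding smooth_supported_def
        by (intro borel_measurable_power) blast
      from integral_lborel_affine[OF this, of \<epsilon> c] show ?thesis
        using \<epsilon> by (simp add: u_def I_def)
    qed
    have "L \<le> (LINT x:\<Omega>|lebesgue. ((1 / \<epsilon>) ^ k * (1 / d x ^ (m - k))) * (u x)\<^sup>2)"
      unfolding L_def u2[symmetric]
    proof (rule integral_square_le[OF u _ sub'])
      show "continuous_on (cball c \<epsilon>) (\<lambda>x. (1 / \<epsilon>) ^ k * (1 / d x ^ (m - k)))"
        by (intro continuous_on_mult continuous_on_const continuous_on_subset[OF cont sub])
      show "(1 / \<epsilon>) ^ k * b \<le> (1 / \<epsilon>) ^ k * (1 / d x ^ (m - k))" if "x \<in> cball c \<epsilon>" for x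
        using b(2) that sub \<epsilon> by (intro mult_left_mono) auto
    qed
    also have "\<dots> = (LINT x:\<Omega>|lebesgue. ?v x * iter_partial js \<Psi> x)"
      unfolding D\<Psi> by (simp add: power2_eq_square mult_ac)
    finally have L: "L \<le> (LINT x:\<Omega>|lebesgue. ?v x * iter_partial js \<Psi> x)" .
    define B where "B = w0 * (?V * \<epsilon> ^ ?n) * (L / (2 * M2 * (?V * \<epsilon> ^ ?n))) powr q"
    have "ennreal (B powr (1 / q)) \<le> sobolev_norm \<Omega> d r k q ?v"
    proof (rule sobolev_norm_ge_weak_deriv[OF js])
      show "q \<ge> 1" "B \<ge> 0"
        using assms w0 \<epsilon> by (auto simp: B_def)
      show "ennreal B \<le> (\<integral>\<^sup>+x\<in>\<Omega>. ennreal (\<bar>w x\<bar> powr q * d x powr r) \<partial>lebesgue)"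
        if "has_weak_deriv \<Omega> js ?v w" for w
        unfolding B_def
        by (rule weighted_integral_weak_deriv_ge[OF that \<Psi> sub' _ _ L])
          (use M2 w0 sub assms \<epsilon> \<open>L > 0\<close> in \<open>auto simp: \<Psi>_def\<close>)
    qed
    also have "B powr (1 / q) = a * \<epsilon> powr (real ?n / q - real k)"
    proof -
      \<comment> \<open>The volume factor \<open>\<epsilon> ^ ?n\<close> in \<open>L\<close>
        cancels, leaving only the \<open>k\<close> derivatives' power of
        \<open>1 / \<epsilon>\<close>.\<close>
      have "L / (2 * M2 * (?V * \<epsilon> ^ ?n)) = b * I / (2 * M2 * ?V) * (1 / \<epsilon>) ^ k"
        using \<epsilon> V M2 by (simp add: L_def field_simps)
      then have "B = (b * I / (2 * M2 * ?V) * (1 / \<epsilon>) ^ k) powr q * w0 * (?V * \<epsilon> ^ ?n)"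
        by (simp add: B_def mult_ac)
      then show ?thesis
        using weighted_norm_scaling[of "b * I / (2 * M2 * ?V)" w0 ?V \<epsilon> q k ?n]
          b I M2 V w0 \<epsilon> assms(5,6) by (simp add: a_def)
    qed
    also note C[OF mem]
    \<comment> \<open>\<open>C\<close> may be negative, in which case \<open>ennreal C\<close> is 0;
      \<open>\<bar>C\<bar>\<close> covers both signs.\<close>
    also have "ennreal C * sobolev_norm \<Omega> d (p - 1) m p u
        \<le> ennreal \<bar>C\<bar> * ennreal (A * \<epsilon> powr (real ?n / p - real m))"
      using upper by (intro mult_mono ennreal_leI) auto
    also have "\<dots> = ennreal (\<bar>C\<bar> * A * \<epsilon> powr (real ?n / p - real m))"
      using M1 by (simp add: ennreal_mult[symmetric] A_def sum_nonneg mult.assoc)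
    finally show ?thesis
      using M1 by (subst (asm) ennreal_le_iff) (auto simp: A_def sum_nonneg)
  qed

  \<comment> \<open>Passage to small scales\<close>
  define \<delta> where "\<delta> = (real ?n / p - real m) - (real ?n / q - real k)"
  have "\<delta> > 0"
  proof -
    \<comment> \<open>Multiplied by the dimension, the exponent hypothesis says that
      \<open>n / q < n / p - (m - k)\<close>, which is positivity of
      \<open>\<delta>\<close>.\<close>
    have "real ?n * (1 / q) < real ?n * ((real ?n - p * (real m - real k)) / (real ?n * p))"
      using assms(7) by (intro mult_strict_left_mono) auto
    also have "\<dots> = real ?n / p - (real m - real k)"
      using assms(5) by (simp add: field_simps)
    finally show ?thesis
      by (simp add: \<delta>_def)
  qed
  have le: "a \<le> \<bar>C\<bar> * A * \<epsilon> powr \<delta>" if "0 < \<epsilon>" "\<epsilon> \<le> R" for \<epsilon>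
  proof -
    have "a * \<epsilon> powr (real ?n / q - real k) \<le> (\<bar>C\<bar> * A * \<epsilon> powr \<delta>) * \<epsilon> powr (real ?n / q - real k)"
      using main[OF that] by (simp add: \<delta>_def mult.assoc powr_add[symmetric])
    then show ?thesis
      using that by (simp add: mult_le_cancel_right)
  qed
  \<comment> \<open>The limit is zero because \<open>0 powr \<delta> = 0\<close>, while the positive
    constant \<open>a\<close> stays below the whole family.\<close>
  have "((\<lambda>\<epsilon>. \<bar>C\<bar> * A * \<epsilon> powr \<delta>) \<longlongrightarrow> \<bar>C\<bar> * A * 0 powr \<delta>) (at_right 0)"
    using \<open>\<delta> > 0\<close> by (intro tendsto_mult_left tendsto_powr') (auto simp: eventually_at_filter)
  moreover have "\<forall>\<^sub>F \<epsilon> in at_right 0. a \<le> \<bar>C\<bar> * A * \<epsilon> powr \<delta>"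
    using le R(1) by (auto simp: eventually_at_right[of 0 1] intro!: exI[of _ R])
  ultimately have "a \<le> \<bar>C\<bar> * A * 0 powr \<delta>"
    by (intro tendsto_lowerbound) auto
  then show False
    using \<open>a > 0\<close> by simp
qed

end
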